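(* Let $k\ge 1$ be a fixed integer. For each sufficiently large real $x$, let $D_k^*=\{d_1^*,\dots,d_k^*\}$ (with $d_1^*<\dots<d_k^*$) be a $k$-tuple prime difference champion for the primes $\le x$, and let $d^*$ be the greatest common divisor of $d_1^*,\dots,d_k^*$. Then $d^*\to\infty$ as $x\to\infty$, and the number of distinct prime factors of $d^*$ also tends to $\infty$ as $x\to\infty$.
   Context: For a set $D_k=\{d_1,\dots,d_k\}$ of $k$ distinct integers with $d_1<d_2<\dots<d_k$ and a real $x$, define $$G_k(x,D_k)=\#\{p\le x-d_k:\ p \text{ prime and } p+d_i \text{ is prime for all } 1\le i\le k\}.$$ A set $D_k^*$ is called a $k$-tuple prime difference champion ($k$-tuple PDC) for the primes $\le x$ if $G_k(x,D_k^* )=\max_{D_k}G_k(x,D_k)$, the maximum being over all sets $D_k$ of $k$ distinct integers.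
   Formalization: The integers d_1,…,d_k, both of the champion and of its competitors in the maximum, are required to be positive; with arbitrary distinct integers the claim fails for k = 1, where {0} is the only champion for x ≥ 3 and has gcd 0. *)

theory Defs
  imports Complex_Main "HOL-Computational_Algebra.Primes"
begin

definition tuple_count :: "real \<Rightarrow> int set \<Rightarrow> nat" where
  "tuple_count x D =
     card {p :: int. prime p \<and> real_of_int p \<le> x - real_of_int (Max D) \<and> (\<forall>d\<in>D. prime (p + d))}"

text \<open>
  The elements of \<open>D\<close> are differences \<open>q - p > 0\<close> between primes \<open>p < q \<le> x\<close>, so they are
  required to be positive. With \<open>0\<close> admitted, \<open>{0}\<close> would be the champion for \<open>k = 1\<close> for all
  large \<open>x\<close>; with \<open>Max D < 0\<close> admitted, \<open>tuple_count\<close> would count primes \<open>p > x\<close>.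
\<close>

definition difference_sets :: "nat \<Rightarrow> int set set" where
  "difference_sets k = {D. finite D \<and> card D = k \<and> (\<forall>d\<in>D. d > 0)}"

definition tuple_PDC :: "nat \<Rightarrow> real \<Rightarrow> int set \<Rightarrow> bool" where
  "tuple_PDC k x D \<longleftrightarrow> is_arg_max (tuple_count x) (\<lambda>D'. D' \<in> difference_sets k) D"

end

theory Submission
  imports Defs "HOL-Number_Theory.Number_Theory" "HOL-Analysis.Harmonic_Numbers"
    "HOL-Real_Asymp.Real_Asymp"
begin

text \<open>
  Let \<open>y\<close> be of order \<open>log x\<close>, let \<open>P\<close> be the product of the primes up to \<open>y\<close>, and let \<open>W\<close> be the
  product of \<open>1 / (1 - 1/p)\<close> over these primes, so that \<open>W \<ge> ln y\<close>. Counting \<open>(k+1)\<close>-sets of primes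
  in a common residue class modulo \<open>P\<close> yields a set of multiples of \<open>P\<close> with count at least of order
  \<open>W^k x / (ln x)^(k+1)\<close>. Conversely, the Brun-Hooley sieve bounds the count of \<open>D\<close> by
  \<open>x / (ln x)^(k+1)\<close> times a local factor at each prime dividing a difference of elements of
  \<open>D \<union> {0}\<close>. A prime not dividing \<open>Gcd D\<close> contributes \<open>(1 - 1/p)^(1-k)\<close> at most, and these primes
  together contribute \<open>O(W^(k-1))\<close>. For a champion the missing factor \<open>W\<close> has to come from the
  primes dividing the gcd, each of which contributes at most \<open>2\<close> more.
\<close>

section \<open>Elementary prime number estimates\<close>

text \<open>The order log x of \<open>y\<close> serves both bounds. By Chebyshev \<open>P\<close>
  \<le> 4^y stays below \<open>x powr (1/4)\<close>, so a class modulo \<open>P\<close> contains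
  many primes on average; and the Euler factors at the O(log x) primes dividing differences multiply
  to at most a constant times \<open>W\<close>. The sieve bound has to be uniform in
  \<open>D\<close>, whose elements may be as large as \<open>x\<close>, so an asymptotic formula for
  a fixed tuple would not do, while constants depending on \<open>k\<close> alone are harmless. The
  same \<open>W\<close> stands in both bounds, so it cancels up to one factor: \<open>W\<close> is
  at most a constant times 2^\<omega>, with \<omega> the number of prime factors of the gcd. Since
  \<open>W\<close> \<ge> ln \<open>y\<close>, this makes \<omega> at least of order log log log x,
  and the gcd, being at least \<omega>, diverges with it.\<close>

lemma prod_primes_dvd:
  fixes m :: nat
  assumes "finite S" "\<And>p. p \<in> S \<Longrightarrow> prime p" "\<And>p. p \<in> S \<Longrightarrow> p dvd m"
  shows "\<Prod>S dvd m"
  using assms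
proof (induction S rule: finite_induct)
  case (insert p S)
  have "coprime r p" if "r \<in> S" for r
    using that insert.prems insert.hyps by (intro primes_coprime) auto
  then have "coprime p (\<Prod>S)"
    by (intro prod_coprime_right) (simp add: coprime_commute)
  then show ?case using insert by (auto intro: divides_mult)
qed simp

lemma finite_primes_le [simp]: "finite {p::nat. prime p \<and> p \<le> n}"
  by (rule finite_subset[of _ "{..n}"]) auto

lemma finite_primes_between [simp]: "finite {p::nat. prime p \<and> m < p \<and> p \<le> n}"
  by (rule finite_subset[of _ "{..n}"]) auto

text \<open>A prime in (n, 2n] divides (2n)! but not n!, hence divides the central binomial
  coefficient.\<close>

lemma prod_primes_between_le:
  "\<Prod>{p::nat. prime p \<and> n < p \<and> p \<le> 2 * n} \<le> 4 ^ n"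
proof -
  have "\<Prod>{p::nat. prime p \<and> n < p \<and> p \<le> 2 * n} dvd ((2 * n) choose n)"
  proof (rule prod_primes_dvd)
    fix p assume "p \<in> {p::nat. prime p \<and> n < p \<and> p \<le> 2 * n}"
    then have p: "prime p" "n < p" "p \<le> 2 * n" by auto
    have "p dvd fact (2 * n)" using p by (simp add: prime_dvd_fact_iff)
    also have "(fact (2 * n) :: nat) = fact n * fact n * ((2 * n) choose n)"
      using binomial_fact_lemma[of n "2 * n"] by (simp add: mult_2)
    finally show "p dvd ((2 * n) choose n)"
      using p by (auto simp: prime_dvd_mult_iff prime_dvd_fact_iff)
  qed auto
  then have "\<Prod>{p::nat. prime p \<and> n < p \<and> p \<le> 2 * n} \<le> (2 * n) choose n"
    by (rule dvd_imp_le) simp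
  also have "\<dots> \<le> 2 ^ (2 * n)" by (rule binomial_le_pow2)
  finally show ?thesis by (simp add: power_mult)
qed

text \<open>The dyadic ranges contribute 4^(1 + 2 + ... + 2^(a-1)) at most. Powers of two suffice
  because the level \<open>y\<close> is chosen as a power of two.\<close>

lemma primorial_le: "\<Prod>{p::nat. prime p \<and> p \<le> 2 ^ a} \<le> 4 ^ (2 ^ a)"
proof (induction a)
  case 0
  have emp: "{p::nat. prime p \<and> p \<le> 2 ^ 0} = {}" by (auto dest: prime_gt_1_nat)
  show ?case unfolding emp by simp
next
  case (Suc a)
  have "{p::nat. prime p \<and> p \<le> 2 ^ Suc a} =
      {p. prime p \<and> p \<le> 2 ^ a} \<union> {p. prime p \<and> 2 ^ a < p \<and> p \<le> 2 * 2 ^ a}"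
    by auto
  then have "\<Prod>{p::nat. prime p \<and> p \<le> 2 ^ Suc a} =
      \<Prod>{p::nat. prime p \<and> p \<le> 2 ^ a} * \<Prod>{p::nat. prime p \<and> 2 ^ a < p \<and> p \<le> 2 * 2 ^ a}"
    by (simp only:) (subst prod.union_disjoint; auto)
  also have "\<dots> \<le> 4 ^ (2 ^ a) * 4 ^ (2 ^ a)"
    by (intro mult_le_mono Suc prod_primes_between_le)
  finally show ?case by (simp add: power_add mult_2)
qed

text \<open>Each of these primes exceeds 2^a, and their product is at most 4^(2^a); the exponents of
  2 are compared.\<close>

lemma card_primes_dyadic_le:
  "card {p::nat. prime p \<and> 2 ^ a < p \<and> p \<le> 2 * 2 ^ a} * a \<le> 2 * 2 ^ a"
proof -
  let ?C = "{p::nat. prime p \<and> 2 ^ a < p \<and> p \<le> 2 * 2 ^ a}"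
  have "(2::nat) ^ (card ?C * a) = (\<Prod>p\<in>?C. 2 ^ a)"
    by (simp add: power_mult[symmetric] mult.commute)
  also have "\<dots> \<le> \<Prod>?C" by (rule prod_mono) auto
  also have "\<dots> \<le> 4 ^ (2 ^ a)" by (rule prod_primes_between_le)
  also have "\<dots> = (2::nat) ^ (2 * 2 ^ a)" by (simp add: power_mult)
  finally show ?thesis by simp
qed

text \<open>Each of the \<open>m\<close> dyadic ranges between 2^m and its square contributes at
  most 2/m. That the bound is independent of \<open>m\<close> makes squaring the natural scale for
  the blocks of the sieve.\<close>

lemma sum_inverse_primes_le:
  assumes "m > 0"
  shows "(\<Sum>p | prime p \<and> 2 ^ m < p \<and> p \<le> (2 ^ (2 * m) :: nat). 1 / real p) \<le> 2"
proof -
  let ?D = "\<lambda>a. {p::nat. prime p \<and> 2 ^ a < p \<and> p \<le> 2 * 2 ^ a}"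
  have block: "(\<Sum>p\<in>?D a. 1 / real p) \<le> 2 / real m" if "a \<ge> m" for a
  proof -
    have "(\<Sum>p\<in>?D a. 1 / real p) \<le> real (card (?D a)) * (1 / 2 ^ a)"
    proof (rule sum_bounded_above)
      fix p assume p: "p \<in> ?D a"
      then have "real (2 ^ a) \<le> real p" by (intro of_nat_mono) auto
      moreover have "real p > 0" using p by (simp add: prime_gt_0_nat)
      ultimately show "1 / real p \<le> 1 / 2 ^ a" by (intro divide_left_mono) auto
    qed
    also have "\<dots> \<le> 2 / real a"
    proof -
      have "real (card (?D a) * a) \<le> real (2 * 2 ^ a)"
        by (intro of_nat_mono card_primes_dyadic_le)
      then show ?thesis using that assms by (simp add: field_simps)
    qed
    also have "\<dots> \<le> 2 / real m" using that assms by (intro divide_left_mono) auto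
    finally show ?thesis .
  qed
  have "{p. prime p \<and> 2 ^ m < p \<and> p \<le> (2 ^ n :: nat)} \<subseteq> (\<Union>a\<in>{m..<n}. ?D a)" if "m \<le> n" for n
    using that
  proof (induction n rule: dec_induct)
    case (step n)
    then show ?case by (auto simp: le_Suc_eq not_le atLeastLessThanSuc)
  qed auto
  from this[of "2 * m"]
  have "(\<Sum>p | prime p \<and> 2 ^ m < p \<and> p \<le> (2 ^ (2 * m) :: nat). 1 / real p)
      \<le> (\<Sum>p\<in>(\<Union>a\<in>{m..<2*m}. ?D a). 1 / real p)"
    by (intro sum_mono2) auto
  also have "\<dots> \<le> (\<Sum>a\<in>{m..<2*m}. \<Sum>p\<in>?D a. 1 / real p)"
  proof -
    have "sum (\<lambda>p. 1 / real p) (\<Union>a\<in>{m..<2*m}. ?D a) = (\<Sum>a\<in>{m..<2*m}. \<Sum>p\<in>?D a. 1 / real p)"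
    proof (rule sum.UNION_disjoint)
      show "\<forall>i\<in>{m..<2*m}. \<forall>j\<in>{m..<2*m}. i \<noteq> j \<longrightarrow> ?D i \<inter> ?D j = {}"
      proof (intro ballI impI)
        fix i j :: nat
        assume "i \<noteq> j"
        have disj: "?D i \<inter> ?D j = {}" if "i < j" for i j
        proof -
          have "(2::nat) * 2 ^ i \<le> 2 ^ j"
            using that power_increasing[of "Suc i" j "2::nat"] by simp
          then show ?thesis by auto
        qed
        from \<open>i \<noteq> j\<close> consider "i < j" | "j < i" by linarith
        then show "?D i \<inter> ?D j = {}"
        proof cases
          case 2
          then show ?thesis by (subst Int_commute) (rule disj)
        qed (rule disj)
      qed
    qed auto
    then show ?thesis by simp
  qed
  also have "\<dots> \<le> (\<Sum>a\<in>{m..<2*m}. 2 / real m)"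
    by (intro sum_mono block) auto
  also have "\<dots> = 2" using assms by simp
  finally show ?thesis .
qed

section \<open>Chebyshev's lower bound for the number of primes\<close>

text \<open>Legendre's formula with a finite cut-off: the new factor \<open>Suc n\<close> raises the
  i-th term by one exactly when \<open>p ^ i\<close> divides it, and the cut-off catches all such
  \<open>i\<close>.\<close>

lemma multiplicity_fact_eq:
  fixes p :: nat
  assumes "prime p" "n < p ^ Suc M"
  shows "multiplicity p (fact n :: nat) = (\<Sum>i=1..M. n div p ^ i)"
  using assms(2)
proof (induction n)
  case (Suc n)
  let ?v = "multiplicity p (Suc n)"
  have p: "p > 1" "prime_elem p" using assms(1) by (auto simp: prime_gt_Suc_0_nat)
  have iff: "p ^ i dvd Suc n \<longleftrightarrow> i \<le> ?v" for i
    using p by (intro power_dvd_iff_le_multiplicity) auto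
  have "p ^ ?v \<le> Suc n" using iff[of ?v] by (auto dest: dvd_imp_le)
  then have "p ^ ?v < p ^ Suc M" using Suc.prems by linarith
  then have "?v < Suc M" using p(1) power_less_imp_less_exp by blast
  then have "?v \<le> M" by simp
  then have "{i\<in>{1..M}. i \<le> ?v} = {1..?v}" by auto
  then have v: "?v = (\<Sum>i=1..M. of_bool (i \<le> ?v))"
    by (simp add: sum.If_cases Int_def)
  have "multiplicity p (fact (Suc n) :: nat) = ?v + multiplicity p (fact n :: nat)"
    using p by (simp only: fact_Suc of_nat_id)
       (subst prime_elem_multiplicity_mult_distrib; simp)
  also have "multiplicity p (fact n :: nat) = (\<Sum>i=1..M. n div p ^ i)"
    using Suc by simp
  also have "?v + \<dots> = (\<Sum>i=1..M. of_bool (i \<le> ?v) + n div p ^ i)"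
    by (subst v) (simp add: sum.distrib)
  also have "\<dots> = (\<Sum>i=1..M. Suc n div p ^ i)"
    by (intro sum.cong refl) (auto simp: div_Suc iff[symmetric] mod_eq_0_iff_dvd)
  finally show ?case .
qed simp

text \<open>In Legendre's formula each of the \<open>M\<close> terms for (2n)! exceeds twice the
  term for n! by at most 1, so the exponent is at most \<open>M\<close>, where \<open>p ^ M\<close>
  \<le> 2n.\<close>

lemma prime_power_multiplicity_central_binomial_le:
  fixes p :: nat
  assumes "prime p" "n > 0"
  shows "p ^ multiplicity p ((2 * n) choose n) \<le> 2 * n"
proof -
  have p: "p \<ge> 2" using assms(1) by (simp add: prime_ge_2_nat)
  obtain M where M: "p ^ M \<le> 2 * n" "2 * n < p ^ Suc M"
    using ex_power_ivl1[OF p, of "2 * n"] assms(2) by auto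
  let ?c = "multiplicity p ((2 * n) choose n)"
  have "(fact (2 * n) :: nat) = fact n * fact n * ((2 * n) choose n)"
    using binomial_fact_lemma[of n "2 * n"] by (simp add: mult_2)
  then have "multiplicity p (fact (2 * n) :: nat) = 2 * multiplicity p (fact n :: nat) + ?c"
    using assms(1) by (simp add: prime_elem_multiplicity_mult_distrib)
  then have "(\<Sum>i=1..M. (2 * n) div p ^ i) = 2 * (\<Sum>i=1..M. n div p ^ i) + ?c"
    using multiplicity_fact_eq[OF assms(1), of n M] multiplicity_fact_eq[OF assms(1) M(2)] M(2)
    by auto
  moreover have "(\<Sum>i=1..M. (2 * n) div p ^ i) \<le> (\<Sum>i=1..M. 2 * (n div p ^ i) + 1)"
  proof (rule sum_mono)
    fix i
    have pos: "p ^ i > 0" using p by simp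
    have "2 * n < p ^ i * (2 * (n div p ^ i) + 2)"
      using dividend_less_times_div[OF pos, of n] by (simp add: algebra_simps)
    then have "(2 * n) div p ^ i < 2 * (n div p ^ i) + 2"
      using pos by (simp add: div_less_iff_less_mult mult.commute)
    then show "(2 * n) div p ^ i \<le> 2 * (n div p ^ i) + 1" by simp
  qed
  moreover have "(\<Sum>i=1..M. 2 * (n div p ^ i) + 1) = 2 * (\<Sum>i=1..M. n div p ^ i) + M"
    by (simp only: sum.distrib sum_distrib_left[symmetric]) simp
  ultimately have "?c \<le> M" by linarith
  then have "p ^ ?c \<le> p ^ M" using p by (intro power_increasing) auto
  with M(1) show ?thesis by simp
qed

text \<open>The central binomial coefficient is at least 4^n / (2n), and it is a product of at most
  \<pi>(2n) prime powers, each at most 2n. The summand 1 absorbs the denominator 2n.\<close>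

lemma chebyshev_lower:
  assumes "n > 0"
  shows "real n * ln 4 \<le> (real (card {p::nat. prime p \<and> p \<le> 2 * n}) + 1) * ln (2 * real n)"
proof -
  let ?C = "(2 * n) choose n" and ?\<pi> = "card {p::nat. prime p \<and> p \<le> 2 * n}"
  have "?C = (\<Prod>p\<in>prime_factors ?C. p ^ multiplicity p ?C)"
    by (rule prime_factorization_nat) simp
  also have "\<dots> \<le> (\<Prod>p\<in>prime_factors ?C. 2 * n)"
    using assms by (intro prod_mono) (auto intro: prime_power_multiplicity_central_binomial_le)
  also have "\<dots> = (2 * n) ^ card (prime_factors ?C)" by simp
  also have "\<dots> \<le> (2 * n) ^ ?\<pi>"
  proof (intro power_increasing card_mono)
    show "prime_factors ?C \<subseteq> {p. prime p \<and> p \<le> 2 * n}"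
    proof
      fix p assume "p \<in> prime_factors ?C"
      then have p: "prime p" "p dvd ?C" by auto
      have "?C dvd fact (2 * n)"
        using binomial_fact_lemma[of n "2 * n"] by (metis dvd_triv_right le_add1 mult_2)
      then have "p dvd fact (2 * n)" using p by (auto intro: dvd_trans)
      then show "p \<in> {p. prime p \<and> p \<le> 2 * n}" using p by (simp add: prime_dvd_fact_iff)
    qed
  qed (use assms in auto)
  finally have "real ?C \<le> real ((2 * n) ^ ?\<pi>)" by (rule of_nat_mono)
  then have "4 ^ n / (2 * real n) \<le> (2 * real n) ^ ?\<pi>"
    using central_binomial_lower_bound[OF assms] by simp
  then have "4 ^ n \<le> (2 * real n) ^ Suc ?\<pi>"
    using assms by (simp add: field_simps)
  then have "ln (4 ^ n) \<le> ln ((2 * real n) ^ Suc ?\<pi>)"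
    by (intro ln_mono) auto
  moreover have "ln (4 ^ n) = real n * ln (4 :: real)" by (simp add: ln_realpow)
  moreover have "ln ((2 * real n) ^ Suc ?\<pi>) = real (Suc ?\<pi>) * ln (2 * real n)"
    using assms by (intro ln_realpow)
  ultimately show ?thesis by (simp add: add.commute)
qed

section \<open>Partial Euler products\<close>

text \<open>The left side is a finite part of the expanded Euler product; the cut-off
  \<open>N\<close> keeps all sums finite.\<close>

lemma sum_inverse_smooth_le:
  fixes P :: "nat set"
  assumes "finite P" "\<And>p. p \<in> P \<Longrightarrow> prime p"
  shows "(\<Sum>m | 0 < m \<and> m \<le> N \<and> prime_factors m \<subseteq> P. 1 / real m) \<le> (\<Prod>p\<in>P. 1 / (1 - 1 / real p))"
  using assms
proof (induction P rule: finite_induct)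
  case empty
  have "{m. 0 < m \<and> m \<le> N \<and> prime_factors m \<subseteq> {}} \<subseteq> {1}"
  proof
    fix m :: nat assume "m \<in> {m. 0 < m \<and> m \<le> N \<and> prime_factors m \<subseteq> {}}"
    then show "m \<in> {1}" by (auto simp: prime_factorization_empty_iff)
  qed
  then have "(\<Sum>m | 0 < m \<and> m \<le> N \<and> prime_factors m \<subseteq> {}. 1 / real m) \<le> (\<Sum>m\<in>{1}. 1 / real m)"
    by (intro sum_mono2) auto
  then show ?case by simp
next
  case (insert p P)
  let ?A = "\<lambda>P. {m. 0 < m \<and> m \<le> N \<and> prime_factors m \<subseteq> P}"
  let ?S = "\<lambda>P. \<Sum>m\<in>?A P. 1 / real m"
  have p: "prime p" "p > 1" using insert.prems by (auto simp: prime_gt_Suc_0_nat)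
  have fin: "finite (?A P)" for P by (rule finite_subset[of _ "{..N}"]) auto
  \<comment> \<open>A multiple of \<open>p\<close> is \<open>p\<close> times a member of the same
    set, so the sum is bounded through itself divided by \<open>p\<close>. Solving this inequality
    replaces the geometric series in 1/p.\<close>
  have "?A (insert p P) \<subseteq> ?A P \<union> (\<lambda>m. p * m) ` ?A (insert p P)"
  proof
    fix m assume m: "m \<in> ?A (insert p P)"
    show "m \<in> ?A P \<union> (\<lambda>m. p * m) ` ?A (insert p P)"
    proof (cases "p dvd m")
      case True
      then obtain l where l: "m = p * l" by (elim dvdE)
      have "prime_factors l \<subseteq> prime_factors m"
        using l m by (intro dvd_prime_factors) auto
      moreover have "l \<le> m" "0 < l" using l m p by auto
      ultimately have "l \<in> ?A (insert p P)" using m by auto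
      then show ?thesis using l by blast
    next
      case False
      then have "p \<notin> prime_factors m" by auto
      then show ?thesis using m by auto
    qed
  qed
  then have "?S (insert p P) \<le> (\<Sum>m\<in>?A P \<union> (\<lambda>m. p * m) ` ?A (insert p P). 1 / real m)"
    using fin by (intro sum_mono2) auto
  also have "\<dots> \<le> ?S P + (\<Sum>m\<in>(\<lambda>m. p * m) ` ?A (insert p P). 1 / real m)"
    using fin by (subst sum_Un) (auto intro!: sum_nonneg)
  also have "(\<Sum>m\<in>(\<lambda>m. p * m) ` ?A (insert p P). 1 / real m) = ?S (insert p P) / real p"
    using p by (subst sum.reindex) (auto simp: inj_on_def sum_divide_distrib mult.commute)
  finally have "?S (insert p P) * (1 - 1 / real p) \<le> ?S P" by (simp add: algebra_simps)
  also have "\<dots> \<le> (\<Prod>p\<in>P. 1 / (1 - 1 / real p))" using insert by auto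
  finally have "?S (insert p P) \<le> (\<Prod>p\<in>P. 1 / (1 - 1 / real p)) / (1 - 1 / real p)"
    using p by (subst pos_le_divide_eq) auto
  then show ?case using insert.hyps by simp
qed

text \<open>Every m \<le> n has only prime factors up to \<open>n\<close>, so the expanded product
  contains the harmonic sum.\<close>

lemma euler_product_ge_ln:
  assumes "n > 0"
  shows "ln (real n) \<le> (\<Prod>p | prime p \<and> p \<le> n. 1 / (1 - 1 / real p))"
proof -
  have "ln (real n) \<le> ln (real n + 1)" using assms by simp
  also have "\<dots> \<le> harm n" by (rule ln_le_harm)
  also have "\<dots> = (\<Sum>m\<in>{1..n}. 1 / real m)" by (simp add: harm_def divide_inverse)
  also have "\<dots> = (\<Sum>m | 0 < m \<and> m \<le> n \<and> prime_factors m \<subseteq> {p. prime p \<and> p \<le> n}. 1 / real m)"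
    by (intro sum.cong) (auto dest!: dvd_imp_le)
  also have "\<dots> \<le> (\<Prod>p | prime p \<and> p \<le> n. 1 / (1 - 1 / real p))"
    by (rule sum_inverse_smooth_le) auto
  finally show ?thesis .
qed

section \<open>The Brun-Hooley sieve\<close>

text \<open>The size condition is an arbitrary predicate so that one recursion serves both
  \<open>card B \<le> m\<close> and \<open>card B = m\<close>.\<close>

lemma sum_subsets_insert:
  fixes f :: "'a set \<Rightarrow> 'b::comm_monoid_add"
  assumes "finite S" "x \<notin> S"
  shows "(\<Sum>B | B \<subseteq> insert x S \<and> Q (card B). f B) =
           (\<Sum>B | B \<subseteq> S \<and> Q (card B). f B) + (\<Sum>B | B \<subseteq> S \<and> Q (Suc (card B)). f (insert x B))"
proof -
  let ?C = "{B. B \<subseteq> S \<and> Q (Suc (card B))}"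
  have fin: "finite B" if "B \<subseteq> S" for B
    using that assms(1) by (rule finite_subset)
  have eq: "{B. B \<subseteq> insert x S \<and> Q (card B)} = {B. B \<subseteq> S \<and> Q (card B)} \<union> insert x ` ?C"
  proof (intro equalityI subsetI)
    fix B assume B: "B \<in> {B. B \<subseteq> insert x S \<and> Q (card B)}"
    show "B \<in> {B. B \<subseteq> S \<and> Q (card B)} \<union> insert x ` ?C"
    proof (cases "x \<in> B")
      case True
      then have 1: "B = insert x (B - {x})" "B - {x} \<subseteq> S" using B by auto
      moreover have "Suc (card (B - {x})) = card B"
        using 1 fin[of "B - {x}"] by (metis card_insert_disjoint Diff_iff insertI1)
      ultimately have "B - {x} \<in> ?C" using B by auto
      with 1(1) show ?thesis by blast
    qed (use B in auto)
  next
    fix B assume "B \<in> {B. B \<subseteq> S \<and> Q (card B)} \<union> insert x ` ?C"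
    moreover have "card (insert x C) = Suc (card C)" if "C \<subseteq> S" for C
      using that fin[of C] assms(2) by (intro card_insert_disjoint) auto
    ultimately show "B \<in> {B. B \<subseteq> insert x S \<and> Q (card B)}" by auto
  qed
  have "inj_on (insert x) ?C"
    using assms(2) by (intro inj_onI) (auto dest!: insert_ident[THEN iffD1, rotated 2])
  moreover have "finite {B. B \<subseteq> S \<and> Q (card B)}" "finite ?C"
    using assms(1) by auto
  moreover have "{B. B \<subseteq> S \<and> Q (card B)} \<inter> insert x ` ?C = {}" using assms(2) by auto
  ultimately show ?thesis
    unfolding eq by (subst sum.union_disjoint) (auto simp: sum.reindex)
qed

lemma subsets_card_le_0: "finite S \<Longrightarrow> {B. B \<subseteq> S \<and> card B \<le> 0} = {{}}"
  by (auto dest: finite_subset)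

lemma subsets_card_eq_0: "finite S \<Longrightarrow> {B. B \<subseteq> S \<and> card B = 0} = {{}}"
  by (auto dest: finite_subset)

lemma prod_insert_sub:
  fixes f :: "'a \<Rightarrow> 'b::comm_monoid_mult"
  assumes "finite S" "x \<notin> S" "B \<subseteq> S"
  shows "prod f (insert x B) = f x * prod f B"
  using assms by (metis prod.insert finite_subset subsetD)

text \<open>Applied in two ways: with indicators as weights, where an even \<open>m\<close> makes
  the truncated sum a pointwise majorant, and with densities, where the second inequality controls
  the loss in the main term.\<close>

lemma bonferroni_weighted:
  fixes w :: "'a \<Rightarrow> real"
  assumes "finite S" "\<And>p. p \<in> S \<Longrightarrow> 0 \<le> w p \<and> w p \<le> 1"
  shows "0 \<le> (-1) ^ m * ((\<Sum>B | B \<subseteq> S \<and> card B \<le> m. \<Prod>p\<in>B. - w p) - (\<Prod>p\<in>S. 1 - w p)) \<and>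
         (-1) ^ m * ((\<Sum>B | B \<subseteq> S \<and> card B \<le> m. \<Prod>p\<in>B. - w p) - (\<Prod>p\<in>S. 1 - w p))
           \<le> (\<Sum>B | B \<subseteq> S \<and> card B = Suc m. \<Prod>p\<in>B. w p)"
  using assms
proof (induction S arbitrary: m rule: finite_induct)
  case empty
  have emp: "{B. B \<subseteq> {} \<and> card B \<le> m} = {{}}" "{B. B \<subseteq> {} \<and> card B = Suc m} = ({} :: 'a set set)"
    by auto
  show ?case unfolding emp by simp
next
  case (insert x S)
  define E where "E = (\<lambda>m. \<Sum>B | B \<subseteq> S \<and> card B \<le> m. \<Prod>p\<in>B. - w p)"
  define e where "e = (\<lambda>m. \<Sum>B | B \<subseteq> S \<and> card B = m. \<Prod>p\<in>B. w p)"
  define V where "V = (\<Prod>p\<in>S. 1 - w p)"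
  have IH: "0 \<le> (-1) ^ m * (E m - V)" "(-1) ^ m * (E m - V) \<le> e (Suc m)" for m
    using insert.IH[of m] insert.prems unfolding E_def e_def V_def by auto
  have wx: "0 \<le> w x" "w x \<le> 1" using insert.prems by auto
  have V: "0 \<le> V" "V \<le> 1"
    unfolding V_def using insert.prems by (auto intro!: prod_nonneg prod_le_1)
  have V': "(\<Prod>p\<in>insert x S. 1 - w p) = (1 - w x) * V"
    using insert.hyps by (simp add: V_def)
  have e': "(\<Sum>B | B \<subseteq> insert x S \<and> card B = Suc m. \<Prod>p\<in>B. w p) = e (Suc m) + w x * e m"
    using insert.hyps
    by (subst sum_subsets_insert[where Q = "\<lambda>c. c = Suc m"])
       (auto simp: e_def sum_distrib_left prod_insert_sub intro!: sum.cong)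
  show ?case
  proof (cases m)
    case 0
    have "e 0 = 1" using insert.hyps by (simp add: e_def subsets_card_eq_0 del: card_eq_0_iff card_0_eq)
    moreover have "(\<Sum>B | B \<subseteq> insert x S \<and> card B \<le> 0. \<Prod>p\<in>B. - w p) = 1" "E 0 = 1"
      using insert.hyps
      unfolding E_def by (subst subsets_card_le_0; simp)+
    moreover have "0 \<le> w x * V" "w x * V \<le> w x"
      using wx V by (auto intro: mult_left_le)
    ultimately show ?thesis
      using IH[of 0] unfolding V' 0 e'[unfolded 0] by (auto simp: algebra_simps)
  next
    case (Suc l)
    have E': "(\<Sum>B | B \<subseteq> insert x S \<and> card B \<le> Suc l. \<Prod>p\<in>B. - w p) = E (Suc l) - w x * E l"
      using insert.hyps
      by (subst sum_subsets_insert[where Q = "\<lambda>c. c \<le> Suc l"])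
         (auto simp: E_def sum_distrib_left prod_insert_sub sum_negf[symmetric] simp del: sum_negf
               intro!: sum.cong)
    \<comment> \<open>The change of sign between \<open>l\<close> and \<open>Suc l\<close> turns the
      subtracted term of the recursion into an added one: the signed error is a nonnegative
      combination of two signed errors for \<open>S\<close>.\<close>
    have eq: "(-1) ^ m * (E (Suc l) - w x * E l - (1 - w x) * V) =
            (-1) ^ m * (E m - V) + w x * ((-1) ^ l * (E l - V))"
      by (simp add: Suc algebra_simps)
    have "0 \<le> w x * ((-1) ^ l * (E l - V))" "w x * ((-1) ^ l * (E l - V)) \<le> w x * e m"
      using IH[of l] wx Suc by (auto intro: mult_left_mono)
    with IH[of m] show ?thesis
      unfolding V' Suc E' e'[unfolded Suc] using eq Suc by auto
  qed
qed

lemma power_add_ge: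
  fixes a w :: real
  assumes "0 \<le> a" "0 \<le> w"
  shows "a ^ Suc n + real (Suc n) * w * a ^ n \<le> (a + w) ^ Suc n"
proof (induction n)
  case (Suc n)
  have "0 \<le> real (Suc n) * w * w * a ^ n" using assms by simp
  then have "a ^ Suc (Suc n) + real (Suc (Suc n)) * w * a ^ Suc n
      \<le> (a + w) * (a ^ Suc n + real (Suc n) * w * a ^ n)"
    by (simp add: algebra_simps)
  also have "\<dots> \<le> (a + w) * (a + w) ^ Suc n"
    using Suc assms by (intro mult_left_mono) auto
  finally show ?case by simp
qed simp

text \<open>When the power is expanded, each product over an \<open>n\<close>-element subset appears
  \<open>fact n\<close> times. The induction replaces this count by the first two terms of a
  binomial expansion.\<close>

lemma elementary_symmetric_le:
  fixes w :: "'a \<Rightarrow> real"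
  assumes "finite S" "\<And>p. p \<in> S \<Longrightarrow> 0 \<le> w p"
  shows "(\<Sum>B | B \<subseteq> S \<and> card B = n. \<Prod>p\<in>B. w p) \<le> (\<Sum>p\<in>S. w p) ^ n / fact n"
  using assms
proof (induction S arbitrary: n rule: finite_induct)
  case empty
  have "{B :: 'a set. B \<subseteq> {} \<and> card B = n} = (if n = 0 then {{}} else {})" by auto
  then show ?case by (cases n) auto
next
  case (insert x S)
  show ?case
  proof (cases n)
    case 0
    then show ?thesis using insert.hyps by (subst 0, subst subsets_card_eq_0) auto
  next
    case (Suc m)
    let ?L = "\<Sum>p\<in>S. w p"
    have L: "0 \<le> ?L" and wx: "0 \<le> w x" using insert.prems by (auto intro: sum_nonneg)
    have "(\<Sum>B | B \<subseteq> insert x S \<and> card B = Suc m. \<Prod>p\<in>B. w p) =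
       (\<Sum>B | B \<subseteq> S \<and> card B = Suc m. \<Prod>p\<in>B. w p) + w x * (\<Sum>B | B \<subseteq> S \<and> card B = m. \<Prod>p\<in>B. w p)"
      using insert.hyps
      by (subst sum_subsets_insert[where Q = "\<lambda>c. c = Suc m"])
         (auto simp: sum_distrib_left prod_insert_sub intro!: sum.cong)
    also have "\<dots> \<le> ?L ^ Suc m / fact (Suc m) + w x * (?L ^ m / fact m)"
      using insert.prems wx by (intro add_mono mult_left_mono insert.IH) auto
    also have "\<dots> = (?L ^ Suc m + real (Suc m) * w x * ?L ^ m) / fact (Suc m)"
      by (simp add: field_simps del: power_Suc of_nat_Suc)
    also have "\<dots> \<le> (?L + w x) ^ Suc m / fact (Suc m)"
      using power_add_ge[OF L wx] by (intro divide_right_mono) auto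
    finally show ?thesis using insert.hyps by (simp add: Suc add.commute)
  qed
qed

text \<open>Each product of at most \<open>n\<close> distinct weights occurs when \<open>n\<close>
  copies of the right-hand factor are multiplied out. This bounds the remainder of a truncated
  block.\<close>

lemma sum_prod_subsets_card_le:
  fixes w :: "'a \<Rightarrow> real"
  assumes "finite S" "\<And>p. p \<in> S \<Longrightarrow> 0 \<le> w p"
  shows "(\<Sum>B | B \<subseteq> S \<and> card B \<le> n. \<Prod>p\<in>B. w p) \<le> (1 + (\<Sum>p\<in>S. w p)) ^ n"
  using assms
proof (induction S arbitrary: n rule: finite_induct)
  case empty
  have "{B :: 'a set. B \<subseteq> {} \<and> card B \<le> n} = {{}}" by auto
  then show ?case by simp
next
  case (insert x S)
  show ?case
  proof (cases n)
    case 0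
    then show ?thesis using insert.hyps by (subst 0, subst subsets_card_le_0) auto
  next
    case (Suc m)
    let ?L = "1 + (\<Sum>p\<in>S. w p)"
    have L: "0 \<le> (\<Sum>p\<in>S. w p)" and wx: "0 \<le> w x" using insert.prems by (auto intro: sum_nonneg)
    have "(\<Sum>B | B \<subseteq> insert x S \<and> card B \<le> Suc m. \<Prod>p\<in>B. w p) =
       (\<Sum>B | B \<subseteq> S \<and> card B \<le> Suc m. \<Prod>p\<in>B. w p) + w x * (\<Sum>B | B \<subseteq> S \<and> card B \<le> m. \<Prod>p\<in>B. w p)"
      using insert.hyps
      by (subst sum_subsets_insert[where Q = "\<lambda>c. c \<le> Suc m"])
         (auto simp: sum_distrib_left prod_insert_sub intro!: sum.cong)
    also have "\<dots> \<le> ?L ^ Suc m + w x * ?L ^ m"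
      using insert.prems wx by (intro add_mono mult_left_mono insert.IH) auto
    also have "\<dots> = (?L + w x) * ?L ^ m"
      by (simp add: algebra_simps)
    also have "\<dots> \<le> (?L + w x) * (?L + w x) ^ m"
      using L wx by (intro mult_left_mono power_mono) auto
    finally show ?thesis using insert.hyps by (simp add: Suc add_ac)
  qed
qed

section \<open>Counting integers in prescribed residue classes\<close>

text \<open>By the Chinese remainder theorem, reduction modulo \<open>p\<close> and modulo the
  product of the other primes is a bijection onto pairs of admissible residues.\<close>

lemma card_residue_system:
  assumes "finite B" "\<And>p::nat. p \<in> B \<Longrightarrow> prime p" "\<And>p. p \<in> B \<Longrightarrow> \<Omega> p \<subseteq> {..<p}"
  shows "card {n. n < \<Prod>B \<and> (\<forall>p\<in>B. n mod p \<in> \<Omega> p)} = (\<Prod>p\<in>B. card (\<Omega> p))"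
  using assms
proof (induction B rule: finite_induct)
  case (insert p B)
  let ?A = "{n. n < \<Prod>B \<and> (\<forall>p\<in>B. n mod p \<in> \<Omega> p)}"
  let ?A' = "{n. n < \<Prod>(insert p B) \<and> (\<forall>p\<in>insert p B. n mod p \<in> \<Omega> p)}"
  have cop: "coprime p (\<Prod>B)"
    using insert.prems insert.hyps by (intro prod_coprime_right) (metis insertCI primes_coprime)
  have pos: "p > 0" "\<Prod>B > 0"
    using insert.prems by (auto simp: prime_gt_0_nat intro!: prod_pos)
  have modmod: "(n mod \<Prod>B) mod r = n mod r" if "r \<in> B" for n r
    using that insert.hyps by (intro mod_mod_cancel dvd_prodI) auto
  have prod: "\<Prod>(insert p B) = p * \<Prod>B" using insert.hyps by simp
  have "bij_betw (\<lambda>n. (n mod p, n mod \<Prod>B)) ?A' (\<Omega> p \<times> ?A)"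
  proof (rule bij_betwI')
    fix n n' assume n: "n \<in> ?A'" "n' \<in> ?A'"
    show "((n mod p, n mod \<Prod>B) = (n' mod p, n' mod \<Prod>B)) = (n = n')"
    proof
      assume "(n mod p, n mod \<Prod>B) = (n' mod p, n' mod \<Prod>B)"
      then have "[n = n'] (mod p)" "[n = n'] (mod \<Prod>B)" by (simp_all add: unique_euclidean_semiring_class.cong_def)
      then have "[n = n'] (mod p * \<Prod>B)"
        using cop by (rule coprime_cong_mult_nat)
      then show "n = n'" using n by (auto simp: prod cong_less_modulus_unique_nat)
    qed auto
  next
    fix n assume "n \<in> ?A'"
    then show "(n mod p, n mod \<Prod>B) \<in> \<Omega> p \<times> ?A"
      using pos by (auto simp: modmod)
  next
    fix y assume y: "y \<in> \<Omega> p \<times> ?A"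
    obtain u v where uv: "y = (u, v)" by fastforce
    have u: "u < p" "v < \<Prod>B" using y uv insert.prems(2)[of p] by auto
    obtain n where n: "n < p * \<Prod>B" "[n = u] (mod p)" "[n = v] (mod \<Prod>B)"
      using binary_chinese_remainder_unique_nat[OF cop, of u v] pos by auto
    have eq: "n mod p = u" "n mod \<Prod>B = v" using n u by (auto simp: unique_euclidean_semiring_class.cong_def)
    have "n mod r \<in> \<Omega> r" if "r \<in> B" for r
      using modmod[OF that, of n] y uv that eq by auto
    then have "n \<in> ?A'" using n eq y uv prod by auto
    then show "\<exists>n\<in>?A'. y = (n mod p, n mod \<Prod>B)" using uv eq by auto
  qed
  then have "card ?A' = card (\<Omega> p \<times> ?A)" by (rule bij_betw_same_card)
  then show ?case
    using insert by (simp add: card_cartesian_product)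
qed simp

text \<open>Complete periods contain exactly \<open>card \<Omega>\<close> hits, so only the last
  incomplete one deviates. The induction removes one period at a time.\<close>

lemma periodic_count:
  fixes q N :: nat
  assumes "\<Omega> \<subseteq> {..<q}" "q > 0"
  shows "\<bar>real (card {n. n < N \<and> n mod q \<in> \<Omega>}) - real N * real (card \<Omega>) / real q\<bar> \<le> real (card \<Omega>)"
proof (induction N rule: less_induct)
  case (less N)
  have fin: "finite \<Omega>" using assms(1) finite_subset by blast
  show ?case
  proof (cases "N < q")
    case True
    then have "card {n. n < N \<and> n mod q \<in> \<Omega>} \<le> card \<Omega>"
      using fin by (intro card_mono) auto
    moreover have "real N * real (card \<Omega>) / real q \<le> real (card \<Omega>)"
      using True assms(2) mult_right_mono[of "real N" "real q" "real (card \<Omega>)"]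
      by (simp add: divide_le_eq mult.commute)
    moreover have "0 \<le> real N * real (card \<Omega>) / real q" by simp
    ultimately show ?thesis by linarith
  next
    case False
    let ?M = "N - q"
    have "{n. n < N \<and> n mod q \<in> \<Omega>} = \<Omega> \<union> (\<lambda>n. n + q) ` {n. n < ?M \<and> n mod q \<in> \<Omega>}"
    proof (intro equalityI subsetI)
      fix n assume n: "n \<in> {n. n < N \<and> n mod q \<in> \<Omega>}"
      show "n \<in> \<Omega> \<union> (\<lambda>n. n + q) ` {n. n < ?M \<and> n mod q \<in> \<Omega>}"
      proof (cases "n < q")
        case False
        then have "n = (n - q) + q" "n - q < ?M" "(n - q) mod q \<in> \<Omega>"
          using n by (auto simp: le_mod_geq)
        then show ?thesis by blast
      qed (use n in auto)
    qed (use assms False in auto)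
    moreover have "\<Omega> \<inter> (\<lambda>n. n + q) ` {n. n < ?M \<and> n mod q \<in> \<Omega>} = {}" using assms by auto
    ultimately have "card {n. n < N \<and> n mod q \<in> \<Omega>} = card \<Omega> + card {n. n < ?M \<and> n mod q \<in> \<Omega>}"
      using fin by (simp add: card_Un_disjoint card_image inj_on_def)
    moreover have "real N * real (card \<Omega>) / real q = real ?M * real (card \<Omega>) / real q + card \<Omega>"
      using False assms(2) by (simp add: field_simps of_nat_diff)
    ultimately show ?thesis using less.IH[of ?M] False assms(2) by simp
  qed
qed

lemma count_residue_conditions:
  fixes N :: nat
  assumes "finite B" "\<And>p::nat. p \<in> B \<Longrightarrow> prime p" "\<And>p. p \<in> B \<Longrightarrow> \<Omega> p \<subseteq> {..<p}"
  shows "\<bar>real (card {n. n < N \<and> (\<forall>p\<in>B. n mod p \<in> \<Omega> p)}) - real N * (\<Prod>p\<in>B. real (card (\<Omega> p)) / real p)\<bar>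
           \<le> (\<Prod>p\<in>B. real (card (\<Omega> p)))"
proof -
  define A where "A = {n. n < \<Prod>B \<and> (\<forall>p\<in>B. n mod p \<in> \<Omega> p)}"
  have pos: "\<Prod>B > 0" using assms by (auto simp: prime_gt_0_nat intro!: prod_pos)
  have modmod: "(n mod \<Prod>B) mod r = n mod r" if "r \<in> B" for n r
    using that assms(1) by (intro mod_mod_cancel dvd_prodI) auto
  have "n mod \<Prod>B \<in> A \<longleftrightarrow> (\<forall>p\<in>B. n mod p \<in> \<Omega> p)" for n
    using pos by (auto simp: A_def modmod)
  moreover have "real (card A) = (\<Prod>p\<in>B. real (card (\<Omega> p)))"
    using card_residue_system[OF assms] by (simp add: A_def)
  moreover have "A \<subseteq> {..<\<Prod>B}" by (auto simp: A_def)
  ultimately show ?thesis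
    using periodic_count[of A "\<Prod>B" N] pos by (simp add: prod_dividef)
qed

text \<open>Expanding the product over the blocks gives one congruence count for each choice of
  subsets. \<open>B0\<close> collects the primes already chosen from treated blocks; this generality
  carries the induction, and the sieve starts from the empty set.\<close>

lemma sieve_expansion:
  fixes P :: "'i \<Rightarrow> nat set" and \<Omega> :: "nat \<Rightarrow> nat set" and N :: nat
  defines "\<rho> \<equiv> \<lambda>p n. of_bool (n mod p \<in> \<Omega> p) :: real"
  assumes "finite I" "\<And>i. i \<in> I \<Longrightarrow> finite (P i)" "\<And>i p. i \<in> I \<Longrightarrow> p \<in> P i \<Longrightarrow> prime p"
    and "disjoint_family_on P I"
    and "\<And>p. \<Omega> p \<subseteq> {..<p}"
    and "finite B0" "\<And>p. p \<in> B0 \<Longrightarrow> prime p" "\<And>i. i \<in> I \<Longrightarrow> B0 \<inter> P i = {}"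
  shows "\<bar>(\<Sum>n<N. (\<Prod>p\<in>B0. \<rho> p n) * (\<Prod>i\<in>I. \<Sum>B | B \<subseteq> P i \<and> card B \<le> m i. \<Prod>p\<in>B. - \<rho> p n))
          - real N * (\<Prod>p\<in>B0. real (card (\<Omega> p)) / real p) *
              (\<Prod>i\<in>I. \<Sum>B | B \<subseteq> P i \<and> card B \<le> m i. \<Prod>p\<in>B. - (real (card (\<Omega> p)) / real p))\<bar>
         \<le> (\<Prod>p\<in>B0. real (card (\<Omega> p))) *
            (\<Prod>i\<in>I. \<Sum>B | B \<subseteq> P i \<and> card B \<le> m i. \<Prod>p\<in>B. real (card (\<Omega> p)))"
  using assms(2-)
proof (induction I arbitrary: B0 rule: finite_induct)
  case empty
  have "(\<Sum>n<N. \<Prod>p\<in>B0. \<rho> p n) = (\<Sum>n<N. of_bool (\<forall>p\<in>B0. n mod p \<in> \<Omega> p))"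
    using empty by (intro sum.cong) (auto simp: \<rho>_def)
  also have "\<dots> = real (card {n. n < N \<and> (\<forall>p\<in>B0. n mod p \<in> \<Omega> p)})"
    by (auto intro!: arg_cong[where f = card])
  finally show ?case
    using count_residue_conditions[of B0 \<Omega> N] empty by simp
next
  case (insert i I)
  let ?c = "\<lambda>p. real (card (\<Omega> p))"
  let ?w = "\<lambda>p. ?c p / real p"
  let ?S = "{B. B \<subseteq> P i \<and> card B \<le> m i}"
  let ?E = "\<lambda>n. \<Prod>i\<in>I. \<Sum>B | B \<subseteq> P i \<and> card B \<le> m i. \<Prod>p\<in>B. - \<rho> p n"
  let ?T = "\<Prod>i\<in>I. \<Sum>B | B \<subseteq> P i \<and> card B \<le> m i. \<Prod>p\<in>B. - ?w p"
  let ?R = "\<Prod>i\<in>I. \<Sum>B | B \<subseteq> P i \<and> card B \<le> m i. \<Prod>p\<in>B. ?c p"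
  have Pi: "finite (P i)" using insert.prems by auto
  have finB: "finite B" if "B \<in> ?S" for B using that Pi finite_subset by auto
  have disj: "B0 \<inter> B = {}" if "B \<in> ?S" for B using that insert.prems(7)[of i] by auto
  have un: "prod f (B0 \<union> B) = prod f B0 * prod f B" if "B \<in> ?S" for f :: "nat \<Rightarrow> real" and B
    using finB[OF that] disj[OF that] insert.prems by (intro prod.union_disjoint) auto
  have main: "\<bar>(\<Sum>n<N. prod (\<lambda>p. \<rho> p n) (B0 \<union> B) * ?E n) - real N * prod ?w (B0 \<union> B) * ?T\<bar>
              \<le> prod ?c (B0 \<union> B) * ?R" if B: "B \<in> ?S" for B
  proof (rule insert.IH)
    show "disjoint_family_on P I"
      using insert.prems(3) by (auto simp: disjoint_family_on_def)
    show "finite (B0 \<union> B)" using insert.prems finB[OF B] by auto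
    show "prime p" if "p \<in> B0 \<union> B" for p
      using that insert.prems(2)[of i p] insert.prems(6)[of p] B by auto
    show "(B0 \<union> B) \<inter> P j = {}" if "j \<in> I" for j
    proof -
      have "P i \<inter> P j = {}"
        using insert.prems(3) insert.hyps that by (auto simp: disjoint_family_on_def)
      then show ?thesis using insert.prems(7)[of j] that B by auto
    qed
  qed (use insert.prems in auto)
  \<comment> \<open>A subset \<open>B\<close> chosen from block \<open>i\<close> joins
    \<open>B0\<close>. Its sign is pulled out, so that the errors of the individual counts add up in
    absolute value.\<close>
  have 1: "(\<Sum>n<N. (\<Prod>p\<in>B0. \<rho> p n) * ((\<Sum>B\<in>?S. \<Prod>p\<in>B. - \<rho> p n) * ?E n))
      = (\<Sum>B\<in>?S. (-1) ^ card B * (\<Sum>n<N. prod (\<lambda>p. \<rho> p n) (B0 \<union> B) * ?E n))"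
    unfolding sum_distrib_left sum_distrib_right
    by (subst sum.swap, intro sum.cong refl) (simp add: un prod_uminus mult_ac)
  have 2: "real N * (\<Prod>p\<in>B0. ?w p) * ((\<Sum>B\<in>?S. \<Prod>p\<in>B. - ?w p) * ?T)
      = (\<Sum>B\<in>?S. (-1) ^ card B * (real N * prod ?w (B0 \<union> B) * ?T))"
    unfolding sum_distrib_left sum_distrib_right
    by (intro sum.cong refl, subst prod_uminus) (simp only: un mult_ac)
  have 3: "(\<Prod>p\<in>B0. ?c p) * ((\<Sum>B\<in>?S. \<Prod>p\<in>B. ?c p) * ?R) = (\<Sum>B\<in>?S. prod ?c (B0 \<union> B) * ?R)"
    unfolding sum_distrib_left sum_distrib_right
    by (intro sum.cong refl) (simp only: un mult_ac)
  have "\<bar>(\<Sum>B\<in>?S. (-1) ^ card B * (\<Sum>n<N. prod (\<lambda>p. \<rho> p n) (B0 \<union> B) * ?E n))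
       - (\<Sum>B\<in>?S. (-1) ^ card B * (real N * prod ?w (B0 \<union> B) * ?T))\<bar>
      = \<bar>\<Sum>B\<in>?S. (-1) ^ card B * ((\<Sum>n<N. prod (\<lambda>p. \<rho> p n) (B0 \<union> B) * ?E n) - real N * prod ?w (B0 \<union> B) * ?T)\<bar>"
    by (simp only: sum_subtractf right_diff_distrib)
  also have "\<dots> \<le> (\<Sum>B\<in>?S. \<bar>(-1) ^ card B * ((\<Sum>n<N. prod (\<lambda>p. \<rho> p n) (B0 \<union> B) * ?E n) - real N * prod ?w (B0 \<union> B) * ?T)\<bar>)"
    by (rule sum_abs)
  also have "\<dots> \<le> (\<Sum>B\<in>?S. prod ?c (B0 \<union> B) * ?R)"
    by (intro sum_mono) (simp only: abs_mult power_abs abs_neg_one power_one mult_1 main)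
  finally show ?case
    unfolding prod.insert[OF insert.hyps] 1 2 3 .
qed

text \<open>The exponents form an arbitrary finite set because the sieve meets only those one above
  its truncation levels.\<close>

lemma sum_power_div_fact_le_exp:
  fixes x :: real
  assumes "0 \<le> x" "finite F"
  shows "(\<Sum>n\<in>F. x ^ n / fact n) \<le> exp x"
proof -
  have "(\<Sum>n\<in>F. x ^ n /\<^sub>R fact n) \<le> exp x"
    unfolding exp_def using assms
    by (intro sum_le_suminf summable_exp_generic) auto
  then show ?thesis by (simp add: divide_inverse mult.commute)
qed

text \<open>Holds because (1 + 2w)(1 - w) \<ge> 1 up to w = 1/2. It bounds the density product of a
  block from below in terms of the sum of its densities.\<close>

lemma exp_minus_twice_le:
  fixes w :: real
  assumes "0 \<le> w" "w \<le> 1 / 2"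
  shows "exp (- 2 * w) \<le> 1 - w"
proof -
  have "1 \<le> (1 + 2 * w) * (1 - w)"
    using mult_left_mono[OF assms(2,1)] by (simp add: algebra_simps)
  also have "\<dots> \<le> exp (2 * w) * (1 - w)"
    using assms by (intro mult_right_mono) auto
  finally show ?thesis by (simp add: exp_minus field_simps)
qed

text \<open>The exact value is 2 * 2^J - J - 2; the geometric weights absorb the linear ones. This
  sum is the exponent of the sieve remainder up to a constant factor.\<close>

lemma sum_power2_mult_diff_le: "(\<Sum>j<J. 2 ^ j * (J - j)) \<le> (2 * 2 ^ J :: nat)"
proof -
  have "(\<Sum>j<J. 2 ^ j * (J - j)) + J + 2 = (2 * 2 ^ J :: nat)"
  proof (induction J)
    case (Suc J)
    have "(\<Sum>j<Suc J. 2 ^ j * (Suc J - j)) = Suc J + 2 * (\<Sum>j<J. 2 ^ j * (J - j) :: nat)"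
      by (subst sum.lessThan_Suc_shift) (simp add: sum_distrib_left mult.assoc)
    with Suc show ?case by simp
  qed simp
  then show ?thesis by linarith
qed

lemma brun_hooley_sieve:
  fixes \<kappa> j0 J N :: nat and \<Omega> :: "nat \<Rightarrow> nat set"
  assumes \<kappa>: "\<kappa> > 0" "2 * \<kappa> \<le> 2 ^ (2 ^ j0)"
    and \<Omega>: "\<And>p. \<Omega> p \<subseteq> {..<p}" "\<And>p. card (\<Omega> p) \<le> \<kappa>"
  defines "Q \<equiv> {p. prime p \<and> 2 ^ (2 ^ j0) < p \<and> p \<le> (2 ^ (2 ^ J) :: nat)}"
  shows "real (card {n. n < N \<and> (\<forall>p\<in>Q. n mod p \<notin> \<Omega> p)})
           \<le> exp (exp (6 * real \<kappa>)) * real N * (\<Prod>p\<in>Q. 1 - real (card (\<Omega> p)) / real p)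
             + (2 ^ (2 ^ J)) ^ 16"
proof -
  \<comment> \<open>The block \<open>P j\<close> of primes between \<open>2 ^ 2 ^ j\<close> and its square gets an inclusion-exclusion
     truncated at \<open>m j\<close> primes. The truncation error decays factorially as \<open>j\<close> decreases, while the
     admitted products of primes stay below a fixed power of \<open>2 ^ 2 ^ J\<close>.\<close>
  define I where "I = {j0..<J}"
  define P where "P = (\<lambda>j. {p. prime p \<and> 2 ^ (2 ^ j) < p \<and> p \<le> (2 ^ (2 * 2 ^ j) :: nat)})"
  \<comment> \<open>Even, so that the truncated sum over a block is an upper bound.\<close>
  define m where "m = (\<lambda>j. 2 * (J - j))"
  define w where "w = (\<lambda>p. real (card (\<Omega> p)) / real p)"
  define \<rho> :: "nat \<Rightarrow> nat \<Rightarrow> real" where "\<rho> = (\<lambda>p n. of_bool (n mod p \<in> \<Omega> p))"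
  define E where "E = (\<lambda>j n. \<Sum>B | B \<subseteq> P j \<and> card B \<le> m j. \<Prod>p\<in>B. - \<rho> p n)"
  define T where "T = (\<lambda>j. \<Sum>B | B \<subseteq> P j \<and> card B \<le> m j. \<Prod>p\<in>B. - w p)"
  define R where "R = (\<lambda>j. \<Sum>B | B \<subseteq> P j \<and> card B \<le> m j. \<Prod>p\<in>B. real (card (\<Omega> p)))"
  define V where "V = (\<lambda>j. \<Prod>p\<in>P j. 1 - w p)"
  \<comment> \<open>Relative truncation error of a block: the factorial term bounds the elementary
    symmetric sum of order \<open>Suc (m j)\<close>, and \<open>exp (4 * real \<kappa>)\<close>
    compensates the lower bound \<open>exp (- 4 * real \<kappa>)\<close> for
    \<open>V j\<close>.\<close>
  define u where "u = (\<lambda>j. exp (4 * real \<kappa>) * ((2 * real \<kappa>) ^ Suc (m j) / fact (Suc (m j))))"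
  have finI: "finite I" and finP: "finite (P j)" for j by (auto simp: I_def P_def)
  have disj: "P i \<inter> P j = {}" if "i < j" for i j
  proof -
    have "(2::nat) ^ Suc i \<le> 2 ^ j" using that by (intro power_increasing) auto
    then have "(2::nat) ^ (2 * 2 ^ i) \<le> 2 ^ (2 ^ j)" by (intro power_increasing) (simp_all only: power_Suc one_le_numeral)
    then show ?thesis by (auto simp: P_def simp del: power_increasing_iff)
  qed
  have disjP: "disjoint_family_on P I"
    unfolding disjoint_family_on_def
    by (metis disj Int_commute linorder_less_linear)
  have Q_sub: "{p. prime p \<and> 2 ^ (2 ^ j0) < p \<and> p \<le> (2 ^ (2 ^ L) :: nat)} = (\<Union>j\<in>{j0..<L}. P j)" if "j0 \<le> L" for L
    using that
  proof (induction L rule: dec_induct)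
    case (step L)
    have "(2::nat) ^ (2 ^ j0) \<le> 2 ^ (2 ^ L)" "(2::nat) ^ (2 ^ L) \<le> 2 ^ (2 ^ Suc L)"
      using step by (auto intro!: power_increasing)
    then have "{p. prime p \<and> 2 ^ (2 ^ j0) < p \<and> p \<le> (2 ^ (2 ^ Suc L) :: nat)} =
        {p. prime p \<and> 2 ^ (2 ^ j0) < p \<and> p \<le> (2 ^ (2 ^ L) :: nat)} \<union> P L"
      by (auto simp: P_def simp del: power_increasing_iff)
    then show ?case using step by (simp add: atLeastLessThanSuc Un_commute)
  qed auto
  have Q: "Q = (\<Union>j\<in>I. P j)"
  proof (cases "j0 \<le> J")
    case False
    then have "(2::nat) ^ (2 ^ J) \<le> 2 ^ (2 ^ j0)" by (intro power_increasing) auto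
    then show ?thesis using False by (auto simp: Q_def I_def simp del: power_increasing_iff)
  qed (use Q_sub in \<open>simp add: Q_def I_def\<close>)
  \<comment> \<open>The purpose of the starting level \<open>j0\<close>: primes above twice
    \<open>\<kappa>\<close> have density at most 1/2, as the lower bound for \<open>V j\<close>
    requires.\<close>
  have large: "2 * \<kappa> < p" if "j \<in> I" "p \<in> P j" for j p
  proof -
    have "(2::nat) ^ (2 ^ j0) \<le> 2 ^ (2 ^ j)" using that by (intro power_increasing) (auto simp: I_def)
    then show ?thesis using that \<kappa> by (auto simp: P_def simp del: power_increasing_iff)
  qed
  have w: "0 \<le> w p" "w p \<le> 1 / 2" if "j \<in> I" "p \<in> P j" for j p
  proof -
    have "2 * card (\<Omega> p) \<le> p" using large[OF that] \<Omega>(2)[of p] by linarith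
    then have "2 * real (card (\<Omega> p)) \<le> real p" by linarith
    then show "0 \<le> w p" "w p \<le> 1 / 2" using large[OF that] by (auto simp: w_def field_simps)
  qed
  have L: "(\<Sum>p\<in>P j. w p) \<le> 2 * real \<kappa>" for j
  proof -
    have "(\<Sum>p\<in>P j. w p) \<le> (\<Sum>p\<in>P j. real \<kappa> * (1 / real p))"
      using \<Omega>(2) by (intro sum_mono) (auto simp: w_def intro!: divide_right_mono)
    also have "\<dots> = real \<kappa> * (\<Sum>p\<in>P j. 1 / real p)" by (simp only: sum_distrib_left)
    also have "\<dots> \<le> real \<kappa> * 2"
      unfolding P_def by (intro mult_left_mono sum_inverse_primes_le) auto
    finally show ?thesis by simp
  qed

  have VQ: "0 \<le> (\<Prod>p\<in>Q. 1 - w p)"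
    using w(2) by (intro prod_nonneg) (fastforce simp: Q)
  have E_ge: "(\<Prod>p\<in>P j. 1 - \<rho> p n) \<le> E j n" for j n
    using bonferroni_weighted[of "P j" "\<lambda>p. \<rho> p n" "m j"] finP
    by (auto simp: E_def \<rho>_def m_def)
  have E_nonneg: "0 \<le> E j n" for j n
    by (rule order.trans[OF _ E_ge]) (auto simp: \<rho>_def intro!: prod_nonneg)
  have "real (card {n. n < N \<and> (\<forall>p\<in>Q. n mod p \<notin> \<Omega> p)}) = (\<Sum>n<N. of_bool (\<forall>p\<in>Q. n mod p \<notin> \<Omega> p))"
    by (auto intro!: arg_cong[where f = card])
  also have "\<dots> \<le> (\<Sum>n<N. \<Prod>j\<in>I. E j n)"
  proof (rule sum_mono)
    fix n
    show "of_bool (\<forall>p\<in>Q. n mod p \<notin> \<Omega> p) \<le> (\<Prod>j\<in>I. E j n)"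
    proof (cases "\<forall>p\<in>Q. n mod p \<notin> \<Omega> p")
      case True
      have "1 \<le> E j n" if "j \<in> I" for j
      proof -
        have "(\<Prod>p\<in>P j. 1 - \<rho> p n) = 1"
          using True that by (intro prod.neutral) (auto simp: Q \<rho>_def)
        then show ?thesis using E_ge[where j = j and n = n] by simp
      qed
      then have "1 \<le> (\<Prod>j\<in>I. E j n)" by (intro prod_ge_1) auto
      then show ?thesis by simp
    next
      case False
      then have "of_bool (\<forall>p\<in>Q. n mod p \<notin> \<Omega> p) = (0 :: real)" by simp
      then show ?thesis using E_nonneg by (simp only:) (intro prod_nonneg, blast)
    qed
  qed
  also have "\<dots> \<le> real N * (\<Prod>j\<in>I. T j) + (\<Prod>j\<in>I. R j)"
  proof -
    have "\<bar>(\<Sum>n<N. (\<Prod>p\<in>{}. \<rho> p n) * (\<Prod>j\<in>I. E j n)) - real N * (\<Prod>p\<in>{}. w p) * (\<Prod>j\<in>I. T j)\<bar>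
        \<le> (\<Prod>p\<in>{}. real (card (\<Omega> p))) * (\<Prod>j\<in>I. R j)"
      unfolding E_def T_def R_def \<rho>_def w_def
      by (rule sieve_expansion[OF finI finP _ disjP \<Omega>(1)]) (auto simp: P_def)
    then have "\<bar>(\<Sum>n<N. \<Prod>j\<in>I. E j n) - real N * (\<Prod>j\<in>I. T j)\<bar> \<le> (\<Prod>j\<in>I. R j)"
      by simp
    from abs_le_D1[OF this] show ?thesis by linarith
  qed
  also have "(\<Prod>j\<in>I. T j) \<le> (\<Prod>p\<in>Q. 1 - w p) * exp (exp (6 * real \<kappa>))"
  proof -
    have T: "0 \<le> T j \<and> T j \<le> V j * (1 + u j)" if j: "j \<in> I" for j
    proof -
      let ?e = "\<Sum>B | B \<subseteq> P j \<and> card B = Suc (m j). prod w B"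
      have w1: "0 \<le> w p \<and> w p \<le> 1" if "p \<in> P j" for p using w[OF j that] by auto
      have V: "exp (- 4 * real \<kappa>) \<le> V j"
      proof -
        have "exp (- 4 * real \<kappa>) \<le> exp (\<Sum>p\<in>P j. - 2 * w p)"
          using L[of j] by (simp add: sum_distrib_left[symmetric] sum_negf)
        also have "\<dots> = (\<Prod>p\<in>P j. exp (- 2 * w p))" using finP by (rule exp_sum)
        also have "\<dots> \<le> V j"
          unfolding V_def using w[OF j] by (intro prod_mono conjI exp_ge_zero exp_minus_twice_le) auto
        finally show ?thesis .
      qed
      have "?e \<le> (\<Sum>p\<in>P j. w p) ^ Suc (m j) / fact (Suc (m j))"
        using w1 finP by (intro elementary_symmetric_le) auto
      also have "\<dots> \<le> (2 * real \<kappa>) ^ Suc (m j) / fact (Suc (m j))"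
        using w1 by (intro divide_right_mono power_mono L sum_nonneg) auto
      also have "\<dots> = exp (- 4 * real \<kappa>) * u j"
        by (simp add: u_def exp_minus field_simps)
      also have "\<dots> \<le> V j * u j"
        using V by (intro mult_right_mono) (auto simp: u_def)
      finally have "?e \<le> V j * u j" .
      moreover have "0 \<le> T j - V j" "T j - V j \<le> ?e"
        using bonferroni_weighted[of "P j" w "m j"] finP w1 by (auto simp: T_def V_def m_def)
      moreover have "0 \<le> V j" using V exp_ge_zero order.trans by blast
      ultimately show ?thesis by (simp add: algebra_simps)
    qed
    have "(\<Prod>j\<in>I. T j) \<le> (\<Prod>j\<in>I. V j * exp (u j))"
    proof (intro prod_mono conjI)
      fix j assume j: "j \<in> I"
      show "0 \<le> T j" using T j by blast
      have "0 \<le> V j" unfolding V_def using w[OF j] by (intro prod_nonneg) fastforce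
      then have "V j * (1 + u j) \<le> V j * exp (u j)"
        by (intro mult_left_mono) auto
      then show "T j \<le> V j * exp (u j)" using T[OF j] by linarith
    qed
    also have "\<dots> = (\<Prod>j\<in>I. V j) * exp (\<Sum>j\<in>I. u j)"
      using finI by (simp add: prod.distrib exp_sum)
    also have "(\<Prod>j\<in>I. V j) = (\<Prod>p\<in>Q. 1 - w p)"
      unfolding Q V_def using finI finP disjP
      by (subst prod.UNION_disjoint) (auto simp: disjoint_family_on_def)
    also have "(\<Sum>j\<in>I. u j) \<le> exp (6 * real \<kappa>)"
    proof -
      \<comment> \<open>The exponents are pairwise distinct, so the sum over the blocks is part of
        the series of \<open>exp (2 * real \<kappa>)\<close>; together with the 4 in
        \<open>u\<close> this gives the 6.\<close>
      have inj: "inj_on (\<lambda>j. Suc (m j)) I" by (auto simp: inj_on_def m_def I_def)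
      have "(\<Sum>j\<in>I. u j) = exp (4 * real \<kappa>) * (\<Sum>n\<in>(\<lambda>j. Suc (m j)) ` I. (2 * real \<kappa>) ^ n / fact n)"
        by (simp only: u_def sum_distrib_left sum.reindex[OF inj] o_def)
      also have "\<dots> \<le> exp (4 * real \<kappa>) * exp (2 * real \<kappa>)"
        using finI by (intro mult_left_mono sum_power_div_fact_le_exp) auto
      also have "\<dots> = exp (6 * real \<kappa>)" by (simp add: exp_add[symmetric])
      finally show ?thesis .
    qed
    finally show ?thesis
      using VQ by (simp add: mult_left_mono)
  qed
  also have "(\<Prod>j\<in>I. R j) \<le> (2 ^ (2 ^ J)) ^ 16"
  proof -
    \<comment> \<open>A block contributes at most the power 2 * \<open>m j\<close> = 4 * (J - j) of
      its upper end 2^(2 * 2^j), whence the 8. Summation over the blocks doubles it to 16.\<close>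
    have "(\<Prod>j\<in>I. R j) \<le> (\<Prod>j\<in>I. 2 ^ (8 * (2 ^ j * (J - j))))"
    proof (intro prod_mono conjI)
      fix j assume j: "j \<in> I"
      show "0 \<le> R j" unfolding R_def by (intro sum_nonneg prod_nonneg) auto
      define y :: nat where "y = 2 ^ (2 * 2 ^ j)"
      have "(2::nat) ^ (2 ^ j0) \<le> y"
      proof -
        have "(2::nat) ^ j0 \<le> 2 ^ Suc j" using j by (intro power_increasing) (auto simp: I_def)
        then show ?thesis
          unfolding y_def by (intro power_increasing) (simp_all only: power_Suc one_le_numeral)
      qed
      then have y: "2 * \<kappa> \<le> y" using \<kappa> by linarith
      have "P j \<subseteq> {1..y}" by (auto simp: P_def y_def Suc_le_eq prime_gt_0_nat)
      then have "card (P j) \<le> y" using card_mono[of "{1..y}" "P j"] by simp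
      have "(\<Sum>p\<in>P j. card (\<Omega> p)) \<le> card (P j) * \<kappa>"
        using sum_bounded_above[of "P j" "\<lambda>p. card (\<Omega> p)" \<kappa>] \<Omega>(2) by simp
      also have "\<dots> \<le> y * \<kappa>" using \<open>card (P j) \<le> y\<close> by simp
      finally have "1 + (\<Sum>p\<in>P j. card (\<Omega> p)) \<le> 1 + y * \<kappa>" by simp
      also have "\<dots> \<le> y * (2 * \<kappa>)"
      proof -
        have "1 * 1 \<le> y * \<kappa>" using \<kappa> y by (intro mult_le_mono) auto
        then show ?thesis by simp
      qed
      also have "\<dots> \<le> y * y" using y by simp
      finally have "real (1 + (\<Sum>p\<in>P j. card (\<Omega> p))) \<le> real (y * y)"
        by (rule of_nat_mono)
      then have y2: "1 + (\<Sum>p\<in>P j. real (card (\<Omega> p))) \<le> real (y * y)" by simp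
      have "R j \<le> (1 + (\<Sum>p\<in>P j. real (card (\<Omega> p)))) ^ m j"
        unfolding R_def using finP by (intro sum_prod_subsets_card_le) auto
      also have "\<dots> \<le> real (y * y) ^ m j"
        using y2 by (intro power_mono) (auto intro!: add_nonneg_nonneg sum_nonneg)
      also have "\<dots> = 2 ^ (8 * (2 ^ j * (J - j)))"
        by (simp add: y_def m_def power_add[symmetric] power_mult[symmetric] algebra_simps)
      finally show "R j \<le> 2 ^ (8 * (2 ^ j * (J - j)))" .
    qed
    also have "\<dots> = 2 ^ (\<Sum>j\<in>I. 8 * (2 ^ j * (J - j)))" by (rule power_sum[symmetric])
    also have "\<dots> \<le> 2 ^ (2 ^ J * 16)"
    proof (rule power_increasing)
      have "(\<Sum>j\<in>I. 8 * (2 ^ j * (J - j))) \<le> (\<Sum>j<J. 8 * (2 ^ j * (J - j)))"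
        by (intro sum_mono2) (auto simp: I_def)
      also have "\<dots> \<le> 8 * (2 * 2 ^ J)"
        unfolding sum_distrib_left[symmetric] by (intro mult_left_mono sum_power2_mult_diff_le) auto
      finally show "(\<Sum>j\<in>I. 8 * (2 ^ j * (J - j))) \<le> 2 ^ J * 16" by simp
    qed simp
    finally show ?thesis by (simp add: power_mult)
  qed
  finally have "real (card {n. n < N \<and> (\<forall>p\<in>Q. n mod p \<notin> \<Omega> p)})
      \<le> real N * ((\<Prod>p\<in>Q. 1 - w p) * exp (exp (6 * real \<kappa>))) + (2 ^ (2 ^ J)) ^ 16"
    by (simp add: mult_left_mono)
  then show ?thesis by (simp add: w_def mult_ac)
qed

section \<open>Upper bound for prime tuples\<close>

text \<open>The quotient P / \<phi>(P) for the product P of the primes up to \<open>n\<close>; by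
  Mertens' third theorem its order is log n.\<close>

definition mertens_product :: "nat \<Rightarrow> real" where
  "mertens_product n = (\<Prod>p | prime p \<and> p \<le> n. 1 / (1 - 1 / real p))"

lemma euler_factor_bounds:
  fixes p :: nat
  assumes "prime p"
  shows "1 \<le> 1 / (1 - 1 / real p)" "1 / (1 - 1 / real p) \<le> 2" "0 < 1 - 1 / real p"
proof -
  have "real p \<ge> 2" using prime_ge_2_nat[OF assms] by simp
  then show "1 \<le> 1 / (1 - 1 / real p)" "1 / (1 - 1 / real p) \<le> 2" "0 < 1 - 1 / real p"
    by (auto simp: field_simps)
qed

lemma mertens_product_ge_1: "1 \<le> mertens_product n"
  unfolding mertens_product_def by (intro prod_ge_1) (auto intro: euler_factor_bounds)

lemma ln_le_mertens_product: "n > 0 \<Longrightarrow> ln (real n) \<le> mertens_product n"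
  unfolding mertens_product_def by (rule euler_product_ge_ln)

lemma prod_euler_factor_mono:
  fixes A B :: "nat set"
  assumes "finite B" "A \<subseteq> B" "\<And>p. p \<in> B \<Longrightarrow> prime p"
  shows "(\<Prod>p\<in>A. 1 / (1 - 1 / real p)) \<le> (\<Prod>p\<in>B. 1 / (1 - 1 / real p))"
proof (rule prod_mono2)
  fix p assume "p \<in> B - A"
  then show "1 \<le> 1 / (1 - 1 / real p)" using assms by (intro euler_factor_bounds) auto
next
  fix p assume "p \<in> A"
  then have "1 \<le> 1 / (1 - 1 / real p)" using assms by (intro euler_factor_bounds) auto
  then show "0 \<le> 1 / (1 - 1 / real p)" by linarith
qed (use assms in auto)

text \<open>
  Applied with \<open>y\<close> of order \<open>log x\<close> to the \<open>O(log x)\<close> primes dividing given differences up to \<open>x\<close>: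
  the exponential is then bounded, and no upper bound of Mertens type is needed.
\<close>

lemma prod_euler_factor_le:
  fixes F :: "nat set"
  assumes F: "finite F" "\<And>p. p \<in> F \<Longrightarrow> prime p" and y: "y > 0"
  shows "(\<Prod>p\<in>F. 1 / (1 - 1 / real p)) \<le> mertens_product y * exp (real (card F) / real y)"
proof -
  let ?a = "\<lambda>p::nat. 1 / (1 - 1 / real p)"
  let ?L = "{p\<in>F. p \<le> y}" and ?U = "{p\<in>F. y < p}"
  have "F = ?L \<union> ?U" by auto
  then have "prod ?a F = prod ?a ?L * prod ?a ?U"
    using F by (metis (no_types, lifting) prod.union_disjoint finite_Un disjoint_iff mem_Collect_eq not_le)
  also have "\<dots> \<le> mertens_product y * exp (real (card F) / real y)"
  proof (rule mult_mono)
    show "prod ?a ?L \<le> mertens_product y"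
      unfolding mertens_product_def using F by (intro prod_euler_factor_mono) auto
    have "prod ?a ?U \<le> (\<Prod>p\<in>?U. exp (1 / real y))"
    proof (intro prod_mono conjI)
      fix p assume p: "p \<in> ?U"
      have "1 \<le> ?a p" using p F by (intro euler_factor_bounds) auto
      then show "0 \<le> ?a p" by linarith
      have "real p \<ge> real y + 1" using p by auto
      then have "?a p \<le> 1 + 1 / real y" using y by (simp add: field_simps)
      also have "\<dots> \<le> exp (1 / real y)" by (rule exp_ge_add_one_self)
      finally show "?a p \<le> exp (1 / real y)" .
    qed
    also have "\<dots> = exp (real (card ?U) / real y)"
      by (simp add: exp_of_nat_mult[symmetric])
    also have "\<dots> \<le> exp (real (card F) / real y)"
      using F y by (auto intro!: divide_right_mono card_mono)
    finally show "prod ?a ?U \<le> exp (real (card F) / real y)" .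
    show "0 \<le> mertens_product y" using mertens_product_ge_1[of y] by linarith
    have "1 \<le> prod ?a ?U" using F by (intro prod_ge_1) (auto intro: euler_factor_bounds)
    then show "0 \<le> prod ?a ?U" by linarith
  qed
  finally show ?thesis .
qed

lemma two_power_card_prime_factors_le:
  fixes m :: nat
  assumes "m > 0"
  shows "2 ^ card (prime_factors m) \<le> m"
proof -
  have "2 ^ card (prime_factors m) = (\<Prod>p\<in>prime_factors m. 2 :: nat)" by simp
  also have "\<dots> \<le> \<Prod>(prime_factors m)"
    by (intro prod_mono) (auto intro: prime_ge_2_nat)
  also have "\<dots> \<le> m"
    using assms by (intro dvd_imp_le prod_primes_dvd) auto
  finally show ?thesis .
qed

text \<open>A prime at which two elements of \<open>H\<close> collide divides their difference, and
  a positive integer below 2^t has at most \<open>t\<close> prime factors.\<close>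

lemma card_primes_dividing_differences:
  fixes H :: "nat set"
  assumes H: "finite H" "\<And>h. h \<in> H \<Longrightarrow> h < 2 ^ t"
  defines "F \<equiv> {p. prime p \<and> \<not> inj_on (\<lambda>h. h mod p) H}"
  shows "finite F" "card F \<le> card H ^ 2 * t"
proof -
  let ?I = "{(h, h'). h \<in> H \<and> h' \<in> H \<and> h < h'}"
  let ?U = "\<Union>(h, h')\<in>?I. prime_factors (h' - h)"
  have I: "?I \<subseteq> H \<times> H" by auto
  then have finI: "finite ?I" using H finite_subset by blast
  have sub: "F \<subseteq> ?U"
  proof
    fix p assume "p \<in> F"
    then obtain h h' where h: "prime p" "h \<in> H" "h' \<in> H" "h \<noteq> h'" "h mod p = h' mod p"
      by (auto simp: F_def inj_on_def)
    have *: "p \<in> ?U" if "u \<in> H" "v \<in> H" "u < v" "u mod p = v mod p" for u v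
    proof -
      have "p dvd v - u"
        using that mod_eq_dvd_iff_nat[of u v p] by simp
      then have "p \<in> prime_factors (v - u)"
        using h(1) that by (auto simp: in_prime_factors_iff)
      then show ?thesis using that by blast
    qed
    from h(4) consider "h < h'" | "h' < h" by linarith
    then show "p \<in> ?U" using *[of h h'] *[of h' h] h by cases auto
  qed
  have finU: "finite ?U" using finI by auto
  then show "finite F" using sub finite_subset by blast
  have "card F \<le> card ?U" using sub finU by (intro card_mono)
  also have "\<dots> \<le> (\<Sum>(h, h')\<in>?I. card (prime_factors (h' - h)))"
    using card_UN_le[OF finI, of "\<lambda>(h, h'). prime_factors (h' - h)"] by (simp add: case_prod_unfold)
  also have "\<dots> \<le> card ?I * t"
  proof -
    have "card (prime_factors (h' - h)) \<le> t" if "h \<in> H" "h' \<in> H" "h < h'" for h h'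
    proof -
      have "(2::nat) ^ card (prime_factors (h' - h)) \<le> h' - h"
        using that by (intro two_power_card_prime_factors_le) auto
      also have "\<dots> < 2 ^ t" using H(2)[OF that(2)] by linarith
      finally show ?thesis by simp
    qed
    then show ?thesis
      using sum_bounded_above[of ?I "\<lambda>(h, h'). card (prime_factors (h' - h))" t] by auto
  qed
  also have "\<dots> \<le> card (H \<times> H) * t"
    using H I by (intro mult_right_mono card_mono) auto
  finally show "card F \<le> card H ^ 2 * t" by (simp add: card_cartesian_product power2_eq_square)
qed

text \<open>The forbidden \<open>r\<close> are the residues of -h, and negation permutes the
  residues modulo \<open>p\<close>.\<close>

lemma card_forbidden_residues:
  fixes H :: "nat set" and p :: nat
  assumes "p > 0"
  shows "card {r. r < p \<and> (\<exists>h\<in>H. p dvd r + h)} = card ((\<lambda>h. h mod p) ` H)"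
proof -
  \<comment> \<open>Negation of a residue in natural arithmetic; the outer \<open>mod\<close> sends
    0 to 0.\<close>
  let ?f = "\<lambda>c. (p - c) mod p"
  have mod0: "?f (h mod p) = r \<longleftrightarrow> p dvd r + h" if "r < p" for r h
  proof -
    have lt: "h mod p < p" using assms by simp
    have "p dvd r + h \<longleftrightarrow> p dvd r + h mod p"
      by (metis mod_add_right_eq mod_eq_0_iff_dvd)
    also have "\<dots> \<longleftrightarrow> r + h mod p = 0 \<or> r + h mod p = p"
    proof
      assume "p dvd r + h mod p"
      then obtain q where q: "r + h mod p = p * q" by blast
      then have "p * q < p * 2" using that lt by linarith
      then have "q = 0 \<or> q = 1" by auto
      then show "r + h mod p = 0 \<or> r + h mod p = p" using q by auto
    qed auto
    also have "\<dots> \<longleftrightarrow> ?f (h mod p) = r"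
      using that lt by (cases "h mod p = 0") auto
    finally show ?thesis by simp
  qed
  have "{r. r < p \<and> (\<exists>h\<in>H. p dvd r + h)} = ?f ` (\<lambda>h. h mod p) ` H"
    using mod0 assms by (auto simp: image_iff) (metis mod_less_divisor mod0)+
  moreover have "inj_on ?f {..<p}"
  proof (rule inj_onI)
    fix c d assume *: "c \<in> {..<p}" "d \<in> {..<p}" "?f c = ?f d"
    then show "c = d" by (cases "c = 0"; cases "d = 0") auto
  qed
  then have "inj_on ?f ((\<lambda>h. h mod p) ` H)"
    by (rule inj_on_subset) (use assms in auto)
  ultimately show ?thesis by (simp add: card_image)
qed

text \<open>The product is a quotient of two Mertens products, and the one at \<open>z\<close> is at
  least \<open>ln z\<close>. Sieving only by primes above \<open>u\<close> costs the factor
  \<open>mertens_product u\<close>, a constant for fixed \<open>u\<close>.\<close>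

lemma prod_one_minus_inverse_primes_le:
  fixes u z :: nat
  assumes "u \<le> z" "z \<ge> 2"
  shows "(\<Prod>p | prime p \<and> u < p \<and> p \<le> z. 1 - 1 / real p) \<le> mertens_product u / ln (real z)"
proof -
  let ?Q = "{p. prime p \<and> u < p \<and> p \<le> z}"
  have lnz: "0 < ln (real z)" using assms by simp
  have M: "0 < mertens_product z" "0 < mertens_product u"
    using mertens_product_ge_1[of z] mertens_product_ge_1[of u] by linarith+
  have "{p. prime p \<and> p \<le> z} = {p. prime p \<and> p \<le> u} \<union> ?Q" using assms by auto
  then have "mertens_product z = mertens_product u * (\<Prod>p\<in>?Q. 1 / (1 - 1 / real p))"
    unfolding mertens_product_def by (simp only:) (subst prod.union_disjoint; auto)
  then have "mertens_product z = mertens_product u / (\<Prod>p\<in>?Q. 1 - 1 / real p)"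
    by (simp add: prod_dividef)
  moreover have "0 < (\<Prod>p\<in>?Q. 1 - 1 / real p)"
    by (intro prod_pos euler_factor_bounds) auto
  ultimately have "(\<Prod>p\<in>?Q. 1 - 1 / real p) = mertens_product u / mertens_product z"
    using M by (simp add: field_simps)
  also have "\<dots> \<le> mertens_product u / ln (real z)"
    using M lnz ln_le_mertens_product[of z] assms by (intro divide_left_mono mult_pos_pos) auto
  finally show ?thesis .
qed

text \<open>
  A prime outside \<open>F\<close> sees at least two classes of \<open>H\<close>, hence misses at most \<open>\<kappa> - 2\<close> of the \<open>\<kappa>\<close>
  expected ones. The loss at primes dividing differences is therefore at most the power \<open>\<kappa> - 2\<close> of
  the Mertens product, up to one more Euler factor at each prime of \<open>F\<close>.
\<close>

lemma prime_tuple_upper_bound: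
  fixes H F :: "nat set" and \<kappa> j0 J N t y :: nat
  assumes H: "finite H" "0 \<in> H" "card H = \<kappa>" "\<And>h. h \<in> H \<Longrightarrow> h < 2 ^ t"
    and \<kappa>: "\<kappa> \<ge> 2" "2 * \<kappa> \<le> 2 ^ (2 ^ j0)" and J: "j0 \<le> J" and y: "y > 0"
    and F: "finite F" "\<And>p. p \<in> F \<Longrightarrow> prime p"
    and HF: "\<And>p. prime p \<Longrightarrow> (\<And>h. h \<in> H \<Longrightarrow> p dvd h) \<Longrightarrow> p \<in> F"
  defines "z \<equiv> 2 ^ (2 ^ J) :: nat"
  shows "real (card {n. n < N \<and> (\<forall>h\<in>H. prime (n + h))})
           \<le> exp (exp (6 * real \<kappa>)) * real N *
               ((mertens_product (2 ^ (2 ^ j0)) / ln (real z)) ^ \<kappa> *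
                (mertens_product y * exp (real (\<kappa>\<^sup>2 * t) / real y)) ^ (\<kappa> - 2) * 2 ^ card F)
             + real z ^ 16 + real z + 1"
proof -
  define Q where "Q = {p. prime p \<and> 2 ^ (2 ^ j0) < p \<and> p \<le> z}"
  define \<Omega> where "\<Omega> = (\<lambda>p. {r. r < p \<and> (\<exists>h\<in>H. p dvd r + h)})"
  define D where "D = {p. prime p \<and> \<not> inj_on (\<lambda>h. h mod p) H}"
  define a where "a = (\<lambda>p::nat. 1 / (1 - 1 / real p))"
  define v where "v = (\<lambda>p::nat. 1 - 1 / real p)"
  have finQ: "finite Q" by (simp add: Q_def)
  have \<Omega>_card: "card (\<Omega> p) = card ((\<lambda>h. h mod p) ` H)" if "p > 0" for p
    unfolding \<Omega>_def using that by (rule card_forbidden_residues)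
  have \<Omega>_le: "card (\<Omega> p) \<le> \<kappa>" for p
  proof (cases "p = 0")
    case False
    then show ?thesis using \<Omega>_card[of p] card_image_le[OF H(1), of "\<lambda>h. h mod p"] H(3) by simp
  qed (simp add: \<Omega>_def)
  have D: "finite D" "card D \<le> \<kappa>\<^sup>2 * t"
    using card_primes_dividing_differences[OF H(1,4)] H(3) by (auto simp: D_def)
  have va: "0 < v p" "v p \<le> 1" "1 \<le> a p" "a p \<le> 2" "a p * v p = 1" if "prime p" for p
    using euler_factor_bounds[OF that] by (auto simp: v_def a_def)
  have factor: "1 - real (card (\<Omega> p)) / real p
      \<le> v p ^ \<kappa> * (if p \<in> D then a p else 1) ^ (\<kappa> - 2) * (if p \<in> F then a p else 1)"
    if p: "prime p" for p
  proof -
    let ?\<omega> = "card (\<Omega> p)"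
    have p0: "p > 0" using p by (simp add: prime_gt_0_nat)
    \<comment> \<open>Bernoulli's inequality turns the density factor into a power of
      \<open>v p\<close>, so that all primes can be compared multiplicatively.\<close>
    have "1 + real ?\<omega> * (- 1 / real p) \<le> (1 + - 1 / real p) ^ ?\<omega>"
      using p0 by (intro Bernoulli_inequality) (simp add: field_simps)
    then have 1: "1 - real ?\<omega> / real p \<le> v p ^ ?\<omega>" by (simp add: v_def)
    show ?thesis
    proof (cases "p \<in> D")
      case False
      then have "?\<omega> = \<kappa>" using p p0 H(3) by (simp add: D_def \<Omega>_card card_image)
      moreover have "v p ^ \<kappa> * 1 \<le> v p ^ \<kappa> * (if p \<in> F then a p else 1)"
        using va[OF p] by (intro mult_left_mono) auto
      ultimately show ?thesis using 1 False by simp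
    next
      case True
      \<comment> \<open>\<open>a p\<close> and \<open>v p\<close> are reciprocal, so all but two of
        the \<open>\<kappa>\<close> factors cancel.\<close>
      have av: "a p ^ (\<kappa> - 2) * v p ^ \<kappa> = v p ^ 2"
      proof -
        have "v p ^ \<kappa> = v p ^ (\<kappa> - 2) * v p ^ 2"
          using \<kappa> by (metis power_add le_add_diff_inverse2)
        then show ?thesis
          using va[OF p] by (simp add: mult.assoc[symmetric] power_mult_distrib[symmetric])
      qed
      show ?thesis
      proof (cases "p \<in> F")
        case False
        then obtain h where h: "h \<in> H" "\<not> p dvd h" using HF[OF p] by blast
        then have "{0, h mod p} \<subseteq> (\<lambda>h. h mod p) ` H" using H(2) by force
        moreover have "card {0, h mod p} = 2" using h by (simp add: dvd_eq_mod_eq_0)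
        ultimately have "2 \<le> ?\<omega>"
          using card_mono[of "(\<lambda>h. h mod p) ` H" "{0, h mod p}"] H(1) by (simp add: \<Omega>_card p0)
        then have "v p ^ ?\<omega> \<le> v p ^ 2" using va[OF p] by (intro power_decreasing) auto
        then show ?thesis using 1 av True False by (simp add: mult.commute)
      next
        case F': True
        \<comment> \<open>At a prime of \<open>F\<close> only one class is guaranteed; the extra
          Euler factor \<open>a p\<close> makes up for the second.\<close>
        have "1 \<le> ?\<omega>"
          using H by (simp add: \<Omega>_card p0 Suc_le_eq card_gt_0_iff) blast
        then have "v p ^ ?\<omega> \<le> v p ^ 1" using va[OF p] by (intro power_decreasing) auto
        also have "\<dots> = a p ^ (\<kappa> - 2) * v p ^ \<kappa> * a p"
        proof -
          have "v p ^ 2 * a p = (a p * v p) * v p" by (simp add: power2_eq_square)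
          then show ?thesis using va[OF p] by (simp only: av) simp
        qed
        finally show ?thesis using 1 True F' by (simp add: mult_ac)
      qed
    qed
  qed
  have small: "0 \<le> 1 - real (card (\<Omega> p)) / real p" if "p \<in> Q" for p
  proof -
    have "card (\<Omega> p) \<le> p" using \<Omega>_le[of p] \<kappa> that by (auto simp: Q_def)
    then show ?thesis using that by (auto simp: Q_def prime_gt_0_nat divide_le_eq)
  qed
  have a_ind: "(\<Prod>p\<in>Q. if p \<in> S then a p else 1) \<le> prod a S"
    if "finite S" "\<And>p. p \<in> S \<Longrightarrow> prime p" for S
  proof -
    have "(\<Prod>p\<in>Q. if p \<in> S then a p else 1) = prod a (Q \<inter> S)"
      using finQ by (simp add: prod.inter_restrict)
    also have "\<dots> \<le> prod a S"
      unfolding a_def using that by (intro prod_euler_factor_mono) auto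
    finally show ?thesis .
  qed
  have a_ind_nonneg: "0 \<le> (\<Prod>p\<in>Q. if p \<in> S then a p else 1)" for S
  proof (rule prod_nonneg)
    fix p assume "p \<in> Q"
    then have "1 \<le> a p" using va by (auto simp: Q_def)
    then show "0 \<le> (if p \<in> S then a p else 1)" by auto
  qed
  have lnz: "0 < ln (real z)" by (simp add: z_def)
  have "(\<Prod>p\<in>Q. 1 - real (card (\<Omega> p)) / real p)
      \<le> (\<Prod>p\<in>Q. v p ^ \<kappa> * (if p \<in> D then a p else 1) ^ (\<kappa> - 2) * (if p \<in> F then a p else 1))"
    using factor small by (intro prod_mono) (auto simp: Q_def)
  also have "\<dots> = prod v Q ^ \<kappa> * (\<Prod>p\<in>Q. if p \<in> D then a p else 1) ^ (\<kappa> - 2) *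
      (\<Prod>p\<in>Q. if p \<in> F then a p else 1)"
    by (simp only: prod.distrib prod_power_distrib)
  also have "\<dots> \<le> (mertens_product (2 ^ (2 ^ j0)) / ln (real z)) ^ \<kappa> *
                (mertens_product y * exp (real (\<kappa>\<^sup>2 * t) / real y)) ^ (\<kappa> - 2) * 2 ^ card F"
  proof (intro mult_mono power_mono)
    have "(2::nat) ^ (2 ^ j0) \<le> z" "2 \<le> z"
      using J power_increasing[of 1 "2 ^ J" "2::nat"] by (auto simp: z_def)
    then show "prod v Q \<le> mertens_product (2 ^ (2 ^ j0)) / ln (real z)"
      unfolding v_def Q_def by (rule prod_one_minus_inverse_primes_le)
    show "0 \<le> prod v Q"
      by (intro prod_nonneg less_imp_le va(1)) (simp add: Q_def)
    have "(\<Prod>p\<in>Q. if p \<in> D then a p else 1) \<le> prod a D"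
      using D by (intro a_ind) (auto simp: D_def)
    also have "\<dots> \<le> mertens_product y * exp (real (card D) / real y)"
      unfolding a_def using D y by (intro prod_euler_factor_le) (auto simp: D_def)
    also have "\<dots> \<le> mertens_product y * exp (real (\<kappa>\<^sup>2 * t) / real y)"
      using D y mertens_product_ge_1[of y] by (intro mult_left_mono) (auto intro!: divide_right_mono simp flip: of_nat_power of_nat_mult)
    finally show "(\<Prod>p\<in>Q. if p \<in> D then a p else 1) \<le> mertens_product y * exp (real (\<kappa>\<^sup>2 * t) / real y)" .
    have "(\<Prod>p\<in>Q. if p \<in> F then a p else 1) \<le> prod a F" using F by (intro a_ind)
    also have "\<dots> \<le> (\<Prod>p\<in>F. 2)"
      by (intro prod_mono conjI va(4) order.trans[OF zero_le_one va(3)] F(2))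
    finally show "(\<Prod>p\<in>Q. if p \<in> F then a p else 1) \<le> 2 ^ card F" by simp
    show "0 \<le> (mertens_product (2 ^ (2 ^ j0)) / ln (real z)) ^ \<kappa>"
      using mertens_product_ge_1[of "2 ^ (2 ^ j0)"] lnz by (intro zero_le_power divide_nonneg_pos) auto
    then show "0 \<le> (mertens_product (2 ^ (2 ^ j0)) / ln (real z)) ^ \<kappa> *
                (mertens_product y * exp (real (\<kappa>\<^sup>2 * t) / real y)) ^ (\<kappa> - 2)"
      by (rule mult_nonneg_nonneg) (simp add: order.trans[OF zero_le_one mertens_product_ge_1])
  qed (auto intro!: zero_le_power a_ind_nonneg)
  finally have main: "(\<Prod>p\<in>Q. 1 - real (card (\<Omega> p)) / real p) \<le>
      (mertens_product (2 ^ (2 ^ j0)) / ln (real z)) ^ \<kappa> *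
                (mertens_product y * exp (real (\<kappa>\<^sup>2 * t) / real y)) ^ (\<kappa> - 2) * 2 ^ card F" .
  \<comment> \<open>For n > z a sieving prime that divides the prime n + h would have to equal it,
    although it is at most \<open>z\<close>. The n \<le> z are counted trivially, whence the summand
    z + 1.\<close>
  have "{n. n < N \<and> (\<forall>h\<in>H. prime (n + h))} \<subseteq> {..z} \<union> {n. n < N \<and> (\<forall>p\<in>Q. n mod p \<notin> \<Omega> p)}"
  proof
    fix n assume n: "n \<in> {n. n < N \<and> (\<forall>h\<in>H. prime (n + h))}"
    have "n mod p \<notin> \<Omega> p" if p: "p \<in> Q" "z < n" for p
    proof
      assume "n mod p \<in> \<Omega> p"
      then obtain h where h: "h \<in> H" "p dvd n mod p + h" by (auto simp: \<Omega>_def)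
      have "p dvd n + h" using h(2) by (metis mod_add_left_eq mod_eq_0_iff_dvd)
      then have "p = n + h" using n h p by (auto simp: Q_def primes_dvd_imp_eq)
      then show False using p by (auto simp: Q_def)
    qed
    then show "n \<in> {..z} \<union> {n. n < N \<and> (\<forall>p\<in>Q. n mod p \<notin> \<Omega> p)}"
      using n by (cases "n \<le> z") auto
  qed
  then have "card {n. n < N \<and> (\<forall>h\<in>H. prime (n + h))}
      \<le> card ({..z} \<union> {n. n < N \<and> (\<forall>p\<in>Q. n mod p \<notin> \<Omega> p)})"
    by (intro card_mono) auto
  also have "\<dots> \<le> card {..z} + card {n. n < N \<and> (\<forall>p\<in>Q. n mod p \<notin> \<Omega> p)}"
    by (rule card_Un_le)
  finally have "real (card {n. n < N \<and> (\<forall>h\<in>H. prime (n + h))})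
      \<le> real z + 1 + real (card {n. n < N \<and> (\<forall>p\<in>Q. n mod p \<notin> \<Omega> p)})"
    by simp
  also have "real (card {n. n < N \<and> (\<forall>p\<in>Q. n mod p \<notin> \<Omega> p)})
      \<le> exp (exp (6 * real \<kappa>)) * real N * (\<Prod>p\<in>Q. 1 - real (card (\<Omega> p)) / real p) + real z ^ 16"
    unfolding Q_def z_def of_nat_power of_nat_numeral
    by (rule brun_hooley_sieve) (use \<kappa> \<Omega>_le in \<open>auto simp: \<Omega>_def\<close>)
  also have "exp (exp (6 * real \<kappa>)) * real N * (\<Prod>p\<in>Q. 1 - real (card (\<Omega> p)) / real p)
      \<le> exp (exp (6 * real \<kappa>)) * real N * ((mertens_product (2 ^ (2 ^ j0)) / ln (real z)) ^ \<kappa> *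
                (mertens_product y * exp (real (\<kappa>\<^sup>2 * t) / real y)) ^ (\<kappa> - 2) * 2 ^ card F)"
    using main by (intro mult_left_mono) auto
  finally show ?thesis by simp
qed

section \<open>Lower bound for the maximal count\<close>

text \<open>Summed over residue classes, this linear minorant replaces the power mean inequality.\<close>

lemma choose_ge_tangent:
  fixes b :: real
  assumes "real (Suc k) \<le> b"
  shows "b ^ k * (real n - b) \<le> real (Suc k) ^ Suc k * real (n choose Suc k)"
proof (cases "b \<le> real n")
  case True
  then have n: "Suc k \<le> n" using assms by linarith
  have "b ^ k * (real n - b) \<le> real n ^ k * real n"
    using assms True by (intro mult_mono power_mono) auto
  also have "\<dots> = real (Suc k) ^ Suc k * (real n / real (Suc k)) ^ Suc k"
    by (simp add: power_divide del: of_nat_Suc)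
  also have "\<dots> \<le> real (Suc k) ^ Suc k * real (n choose Suc k)"
    using n by (intro mult_left_mono binomial_ge_n_over_k_pow_k) auto
  finally show ?thesis .
next
  case False
  then have "b ^ k * (real n - b) \<le> 0"
    using assms by (intro mult_nonneg_nonpos) auto
  also have "0 \<le> real (Suc k) ^ Suc k * real (n choose Suc k)" by simp
  finally show ?thesis .
qed

text \<open>Primes above \<open>y\<close> occupy only \<phi>(P) of the P classes modulo P; this
  quotient is the resulting gain for each difference.\<close>

lemma primorial_div_totient:
  defines "P \<equiv> \<lambda>y. \<Prod>{p::nat. prime p \<and> p \<le> y}"
  shows "real (P y) / real (totient (P y)) = mertens_product y"
proof -
  have P: "P y > 0" unfolding P_def by (intro prod_pos) (auto simp: prime_gt_0_nat)
  have "p dvd P y \<longleftrightarrow> p \<le> y" if p: "prime p" for p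
  proof
    assume "p dvd P y"
    then obtain q where "prime q" "q \<le> y" "p dvd q"
      using prime_dvd_prod_iff[of "{p. prime p \<and> p \<le> y}" p "\<lambda>q. q"] p by (auto simp: P_def)
    then show "p \<le> y" using that primes_dvd_imp_eq by blast
  next
    assume "p \<le> y"
    then show "p dvd P y" unfolding P_def using that by (intro dvd_prodI) auto
  qed
  then have "prime_factors (P y) = {p. prime p \<and> p \<le> y}"
    using P by (auto simp: in_prime_factors_iff)
  then have "real (totient (P y)) = real (P y) * (\<Prod>p | prime p \<and> p \<le> y. 1 - 1 / real p)"
    by (simp add: totient_formula2)
  then show ?thesis
    using P by (simp add: mertens_product_def prod_dividef)
qed

text \<open>
  A set of \<open>k + 1\<close> primes in one residue class modulo \<open>P\<close> is determined by its minimum and by its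
  differences to the minimum, which are multiples of \<open>P\<close>; so few difference sets share many tuples.
\<close>

lemma tuple_count_lower_bound:
  fixes k y X :: nat and x G :: real
  assumes k: "k \<ge> 1" and y: "y \<ge> 2" and X: "real X \<le> x"
  defines "P \<equiv> \<Prod>{p::nat. prime p \<and> p \<le> y}"
    and "M \<equiv> card {p::nat. prime p \<and> y < p \<and> p \<le> X}"
  assumes big: "2 * (k + 1) * P \<le> M"
    and G: "\<And>E. E \<in> difference_sets k \<Longrightarrow> real (tuple_count x E) \<le> G"
  shows "real M ^ (k + 1) * mertens_product y ^ k
           \<le> (2 * real (k + 1)) ^ (k + 1) * real X ^ k * G"
proof -
  define N where "N = (\<lambda>r. {p::nat. prime p \<and> y < p \<and> p \<le> X \<and> p mod P = r})"
  define \<T> where "\<T> = (\<lambda>r. {T. T \<subseteq> N r \<and> card T = Suc k})"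
  define B where "B = {d. 1 \<le> d \<and> d \<le> X \<and> P dvd d}"
  define \<D> where "\<D> = {A. A \<subseteq> B \<and> card A = k}"
  define S where "S = (\<lambda>A. {m::nat. prime m \<and> (\<forall>d\<in>A. prime (m + d) \<and> m + d \<le> X)})"
  define \<Phi> where "\<Phi> = (\<lambda>T. ((\<lambda>p. p - Min T) ` (T - {Min T}), Min T :: nat))"
  \<comment> \<open>Half the average number of primes per class: the tangent inequality, summed over
    the classes, then still retains half of \<open>M\<close>.\<close>
  define b where "b = real M / (2 * real (totient P))"

  \<comment> \<open>For \<open>P\<close> = 1 every residue is 0 while the only totative is 1;
    \<open>y\<close> \<ge> 2 excludes this case.\<close>
  have "2 dvd P" unfolding P_def using y by (intro dvd_prodI) auto
  moreover have P0: "P > 0" unfolding P_def by (intro prod_pos) (auto simp: prime_gt_0_nat)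
  ultimately have P: "P > 1" by (auto dest: dvd_imp_le)
  have finN: "finite (N r)" for r by (rule finite_subset[of _ "{..X}"]) (auto simp: N_def)
  have finB: "finite B" by (rule finite_subset[of _ "{..X}"]) (auto simp: B_def)
  have fin\<T>: "finite (\<T> r)" for r
    by (rule finite_subset[of _ "Pow (N r)"]) (auto simp: \<T>_def finN)
  have fin\<D>: "finite \<D>" by (rule finite_subset[of _ "Pow B"]) (auto simp: \<D>_def finB)
  have residue: "p mod P \<in> totatives P" if "prime p" "y < p" for p
  proof -
    have "coprime p P"
      unfolding P_def using that by (intro prod_coprime_right primes_coprime) auto
    then have c: "coprime (p mod P) P" using P by simp
    moreover have "p mod P \<noteq> 0"
    proof
      assume "p mod P = 0"
      with c P show False by simp
    qed
    ultimately show ?thesis using P by (auto simp: in_totatives_iff less_imp_le)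
  qed
  have "{p::nat. prime p \<and> y < p \<and> p \<le> X} = (\<Union>r\<in>totatives P. N r)"
    using residue by (auto simp: N_def)
  then have sumN: "M = (\<Sum>r\<in>totatives P. card (N r))"
    unfolding M_def by (simp only:) (subst card_UN_disjoint; auto simp: N_def)

  have \<T>_mem: "finite T" "T \<noteq> {}" "Min T \<in> T" "T = insert (Min T) ((+) (Min T) ` fst (\<Phi> T))"
    if "T \<in> \<T> r" for T r
  proof -
    show T: "finite T" "T \<noteq> {}"
      using that finN[of r] by (auto simp: \<T>_def dest: finite_subset)
    then show m: "Min T \<in> T" by (rule Min_in)
    have "(+) (Min T) ` fst (\<Phi> T) = T - {Min T}"
      using T by (force simp: \<Phi>_def image_image)
    then show "T = insert (Min T) ((+) (Min T) ` fst (\<Phi> T))" using m by auto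
  qed
  have "(\<Sum>r\<in>totatives P. card (N r) choose Suc k) = (\<Sum>r\<in>totatives P. card (\<T> r))"
    unfolding \<T>_def by (intro sum.cong refl n_subsets[symmetric] finN)
  also have "\<dots> = card (\<Union>r\<in>totatives P. \<T> r)"
  proof (rule card_UN_disjoint[symmetric])
    show "\<forall>i\<in>totatives P. \<forall>j\<in>totatives P. i \<noteq> j \<longrightarrow> \<T> i \<inter> \<T> j = {}"
    proof (intro ballI impI equals0I)
      fix i j T assume "i \<noteq> j" "T \<in> \<T> i \<inter> \<T> j"
      then have "Min T \<in> N i \<inter> N j" using \<T>_mem(3)[of T i] by (auto simp: \<T>_def)
      with \<open>i \<noteq> j\<close> show False by (auto simp: N_def)
    qed
  qed (use fin\<T> in auto)
  also have "\<dots> \<le> card (SIGMA A:\<D>. S A)"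
  proof (rule card_inj_on_le)
    show "inj_on \<Phi> (\<Union>r\<in>totatives P. \<T> r)"
    proof (rule inj_onI)
      fix T T' assume *: "T \<in> (\<Union>r\<in>totatives P. \<T> r)" "T' \<in> (\<Union>r\<in>totatives P. \<T> r)" "\<Phi> T = \<Phi> T'"
      then obtain r r' where r: "T \<in> \<T> r" "T' \<in> \<T> r'" by blast
      have "Min T = Min T'" using *(3) by (simp add: \<Phi>_def)
      with \<T>_mem(4)[OF r(1)] \<T>_mem(4)[OF r(2)] *(3) show "T = T'" by metis
    qed
    show "\<Phi> ` (\<Union>r\<in>totatives P. \<T> r) \<subseteq> (SIGMA A:\<D>. S A)"
    proof
      fix z assume "z \<in> \<Phi> ` (\<Union>r\<in>totatives P. \<T> r)"
      then obtain r T where T: "T \<in> \<T> r" "z = \<Phi> T" by blast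
      note mem = \<T>_mem(1-3)[OF T(1)]
      have TN: "T \<subseteq> N r" "card T = Suc k" using T(1) by (auto simp: \<T>_def)
      have lt: "Min T < p" if "p \<in> T - {Min T}" for p
      proof -
        have "Min T \<le> p" "p \<noteq> Min T" using that mem(1) by (auto intro: Min_le)
        then show ?thesis by linarith
      qed
      have dv: "P dvd p - Min T" if "p \<in> T - {Min T}" for p
      proof -
        have "p \<in> N r" "Min T \<in> N r" using that TN(1) mem(3) by blast+
        then have "p mod P = Min T mod P" by (simp add: N_def)
        then show ?thesis using lt[OF that] mod_eq_dvd_iff_nat[of "Min T" p P] by simp
      qed
      have inj: "inj_on (\<lambda>p. p - Min T) (T - {Min T})"
        using lt by (intro inj_onI) (metis le_add_diff_inverse less_imp_le)
      have "fst (\<Phi> T) \<in> \<D>"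
      proof -
        have "fst (\<Phi> T) \<subseteq> B"
          using lt dv TN by (fastforce simp: \<Phi>_def B_def N_def Suc_le_eq)
        moreover have "card (fst (\<Phi> T)) = k"
          using inj mem TN by (simp add: \<Phi>_def card_image)
        ultimately show ?thesis by (simp add: \<D>_def)
      qed
      moreover have "Min T \<in> S (fst (\<Phi> T))"
      proof -
        have "Min T \<in> N r" using TN(1) mem(3) by blast
        then have "prime (Min T)" by (simp add: N_def)
        moreover have "prime (Min T + (p - Min T)) \<and> Min T + (p - Min T) \<le> X" if "p \<in> T - {Min T}" for p
        proof -
          have "p \<in> N r" using that TN(1) by blast
          then show ?thesis using lt[OF that] by (simp add: N_def)
        qed
        ultimately show ?thesis by (auto simp: S_def \<Phi>_def)
      qed
      ultimately show "z \<in> (SIGMA A:\<D>. S A)" using T(2) by (simp add: \<Phi>_def)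
    qed
    show "finite (SIGMA A:\<D>. S A)"
    proof (rule finite_SigmaI[OF fin\<D>])
      fix A assume "A \<in> \<D>"
      \<comment> \<open>For empty \<open>A\<close> the set \<open>S A\<close> would consist of all
        primes.\<close>
      then have "card A \<noteq> 0" using k by (simp add: \<D>_def)
      then obtain d where "d \<in> A" by fastforce
      then show "finite (S A)" by (intro finite_subset[of "S A" "{..X}"]) (auto simp: S_def)
    qed
  qed
  also have "\<dots> \<le> (\<Sum>A\<in>\<D>. tuple_count x (int ` A))"
  proof -
    have *: "finite (S A) \<and> card (S A) \<le> tuple_count x (int ` A)" if A: "A \<in> \<D>" for A
    proof -
      have finA: "finite A" "A \<noteq> {}" using A k finB by (auto simp: \<D>_def dest: finite_subset)
      let ?C = "{p :: int. prime p \<and> real_of_int p \<le> x - real_of_int (Max (int ` A)) \<and> (\<forall>d\<in>int ` A. prime (p + d))}"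
      have "finite ?C"
        by (rule finite_subset[of _ "{0..\<lfloor>x - real_of_int (Max (int ` A))\<rfloor>}"])
           (auto simp: prime_ge_0_int, linarith)
      moreover have "int ` S A \<subseteq> ?C"
      proof
        fix p assume "p \<in> int ` S A"
        then obtain m where m: "p = int m" "m \<in> S A" by auto
        have "Max (int ` A) \<in> int ` A" using finA by (intro Max_in) auto
        then obtain d where d: "d \<in> A" "Max (int ` A) = int d" by auto
        have "real (m + d) \<le> real X" using m d by (intro of_nat_mono) (auto simp: S_def)
        then have "real m \<le> x - real d" using X by simp
        moreover have "prime (int m + int e)" if "e \<in> A" for e
          using m that by (auto simp: S_def simp flip: of_nat_add)
        ultimately show "p \<in> ?C" using m d by (auto simp: S_def)
      qed
      ultimately have "finite (int ` S A)" "card (int ` S A) \<le> card ?C"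
        by (auto intro: finite_subset card_mono)
      then show ?thesis
        by (simp add: tuple_count_def card_image finite_image_iff)
    qed
    then show ?thesis using fin\<D> by (simp add: sum_mono)
  qed
  finally have "(\<Sum>r\<in>totatives P. real (card (N r) choose Suc k)) \<le> (\<Sum>A\<in>\<D>. real (tuple_count x (int ` A)))"
    by (simp flip: of_nat_sum)
  also have "\<dots> \<le> (\<Sum>A\<in>\<D>. G)"
  proof (intro sum_mono G)
    fix A assume "A \<in> \<D>"
    then show "int ` A \<in> difference_sets k"
      using finB by (auto simp: \<D>_def difference_sets_def card_image B_def dest: finite_subset)
  qed
  also have "\<dots> = real (card \<D>) * G" by simp
  \<comment> \<open>All differences lie among the at most X/P multiples of \<open>P\<close>. The
    power of \<open>P\<close> saved here, against the power of the totient in \<open>b\<close>,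
    yields the k-th power of the Mertens product.\<close>
  also have "\<dots> \<le> (real X / real P) ^ k * G"
  proof (rule mult_right_mono)
    have "B \<subseteq> (*) P ` {1..X div P}"
    proof
      fix d assume d: "d \<in> B"
      then obtain q where q: "d = P * q" by (auto simp: B_def)
      then have "q \<in> {1..X div P}" using d P by (auto simp: B_def less_eq_div_iff_mult_less_eq mult.commute Suc_le_eq)
      then show "d \<in> (*) P ` {1..X div P}" using q by blast
    qed
    then have "card B \<le> card {1..X div P}" by (rule surj_card_le[rotated]) simp
    then have "card B \<le> X div P" by simp
    then have "card B * P \<le> X" using P0 by (simp add: less_eq_div_iff_mult_less_eq)
    then have "real (card B) \<le> real X / real P"
      using P0 by (simp add: pos_le_divide_eq flip: of_nat_mult)
    moreover have "card B choose k \<le> card B ^ k"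
      by (cases "k \<le> card B") (simp_all add: binomial_le_pow binomial_eq_0 not_le)
    then have "card \<D> \<le> card B ^ k" unfolding \<D>_def using n_subsets[OF finB] by simp
    then have "real (card \<D>) \<le> real (card B) ^ k" by (simp flip: of_nat_power)
    ultimately show "real (card \<D>) \<le> (real X / real P) ^ k"
      by (meson order.trans power_mono of_nat_0_le_iff)
    have "int ` {1..k} \<in> difference_sets k" by (auto simp: difference_sets_def card_image)
    from G[OF this] show "0 \<le> G" by (meson order.trans of_nat_0_le_iff)
  qed
  finally have upper: "(\<Sum>r\<in>totatives P. real (card (N r) choose Suc k)) \<le> (real X / real P) ^ k * G" .

  have \<phi>: "totient P > 0" "totient P \<le> P" using P0 by (auto simp: totient_le)
  have "2 * (k + 1) * totient P \<le> M" using big \<phi> by (meson order.trans mult_le_mono2)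
  then have "real (2 * (k + 1) * totient P) \<le> real M" by (rule of_nat_mono)
  then have b: "real (Suc k) \<le> b" using \<phi> by (simp add: b_def field_simps)
  have "b ^ k * (real M / 2) = b ^ k * (real M - real (totient P) * b)"
    using \<phi> by (simp add: b_def)
  also have "\<dots> = (\<Sum>r\<in>totatives P. b ^ k * (real (card (N r)) - b))"
    by (simp add: sumN sum_subtractf totient_def right_diff_distrib sum_distrib_left[symmetric])
  also have "\<dots> \<le> (\<Sum>r\<in>totatives P. real (Suc k) ^ Suc k * real (card (N r) choose Suc k))"
    using b by (intro sum_mono choose_ge_tangent)
  also have "\<dots> \<le> real (Suc k) ^ Suc k * ((real X / real P) ^ k * G)"
    unfolding sum_distrib_left[symmetric] by (intro mult_left_mono upper) simp
  finally have "(b ^ k * (real M / 2)) * (2 ^ Suc k * real P ^ k)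
      \<le> (real (Suc k) ^ Suc k * ((real X / real P) ^ k * G)) * (2 ^ Suc k * real P ^ k)"
    by (intro mult_right_mono) auto
  moreover have "(b ^ k * (real M / 2)) * (2 ^ Suc k * real P ^ k) = real M ^ Suc k * (real P / real (totient P)) ^ k"
    by (simp add: b_def power_divide power_mult_distrib field_simps)
  moreover have "(real (Suc k) ^ Suc k * ((real X / real P) ^ k * G)) * (2 ^ Suc k * real P ^ k)
      = (2 * real (Suc k)) ^ Suc k * real X ^ k * G"
    using P0 by (simp add: power_divide power_mult_distrib field_simps del: of_nat_Suc)
  ultimately have "real M ^ Suc k * (real P / real (totient P)) ^ k
      \<le> (2 * real (Suc k)) ^ Suc k * real X ^ k * G"
    by (simp only:)
  moreover have "real P / real (totient P) = mertens_product y"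
    unfolding P_def by (rule primorial_div_totient)
  ultimately show ?thesis by (simp only: Suc_eq_plus1)
qed

section \<open>Champions\<close>

text \<open>Rounds the parameters to powers of two, the points where the primorial bound and the
  sieve levels are available.\<close>

lemma ex_power2_between:
  fixes r :: real
  assumes "r \<ge> 1"
  shows "\<exists>a. 2 ^ a \<le> r \<and> r < 2 * 2 ^ a"
proof -
  define m where "m = nat \<lfloor>r\<rfloor>"
  have m: "m \<ge> 1" "real m \<le> r" "r < real m + 1" using assms unfolding m_def by linarith+
  then obtain a where a: "2 ^ a \<le> m" "m < 2 ^ (a + 1)"
    using ex_power_ivl1[of 2 m] by auto
  have "2 ^ a \<le> real m"
    using of_nat_mono[OF a(1), where 'a = real] by (simp only: of_nat_power of_nat_numeral)
  moreover have "real (m + 1) \<le> real (2 ^ (a + 1))" using a(2) by (intro of_nat_mono) simp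
  then have "real m + 1 \<le> 2 * 2 ^ a" by simp
  ultimately have "2 ^ a \<le> r \<and> r < 2 * 2 ^ a" using m(2,3) by linarith
  then show ?thesis by blast
qed

lemma power2_le_powr:
  fixes x c :: real
  assumes "x > 0" "real n \<le> c * log 2 x"
  shows "2 ^ n \<le> x powr c"
proof -
  have "(2::real) ^ n = 2 powr real n" by (simp add: powr_realpow)
  also have "\<dots> \<le> 2 powr (c * log 2 x)" using assms by (intro powr_mono) auto
  also have "\<dots> = (2 powr log 2 x) powr c" by (simp only: powr_powr mult.commute)
  also have "\<dots> = x powr c" using assms by simp
  finally show ?thesis .
qed

section \<open>The two bounds for large x\<close>

text \<open>Chebyshev's bound at half of \<open>x\<close> gives about x / (2 ln x) primes; the 8
  leaves room for rounding and for the at most \<open>y\<close> discarded primes.\<close>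

lemma card_primes_ge_eventually:
  "eventually (\<lambda>x::real. \<forall>y. real y \<le> log 2 x / 8 \<longrightarrow>
     x / (8 * ln x) \<le> real (card {p::nat. prime p \<and> y < p \<and> p \<le> nat \<lfloor>x\<rfloor>})) at_top"
proof -
  have "eventually (\<lambda>x::real. x / (8 * ln x) \<le> (x / 2 - 1) / ln x - 1 - log 2 x / 8) at_top"
    by real_asymp
  moreover have "eventually (\<lambda>x::real. x \<ge> 4) at_top" by (rule eventually_ge_at_top)
  ultimately show ?thesis
  proof eventually_elim
    case (elim x)
    let ?X = "nat \<lfloor>x\<rfloor>" and ?n = "nat \<lfloor>x / 2\<rfloor>"
    let ?\<pi> = "\<lambda>n. {p::nat. prime p \<and> p \<le> n}"
    have n: "?n > 0" "2 * ?n \<le> ?X" "x / 2 - 1 \<le> real ?n" "2 * real ?n \<le> x"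
      using elim(2) by linarith+
    have lnx: "ln x > 0" using elim(2) by simp
    have "exp 1 \<le> (4 :: real)" using exp_le by linarith
    then have "1 \<le> ln (4 :: real)" by (subst ln_ge_iff) auto
    then have "x / 2 - 1 \<le> real ?n * ln 4"
      using n(3) mult_left_mono[of 1 "ln 4" "real ?n"] by simp
    also have "\<dots> \<le> (real (card (?\<pi> (2 * ?n))) + 1) * ln (2 * real ?n)"
      by (rule chebyshev_lower[OF n(1)])
    also have "\<dots> \<le> (real (card (?\<pi> ?X)) + 1) * ln x"
    proof (intro mult_mono add_mono of_nat_mono card_mono)
      show "?\<pi> (2 * ?n) \<subseteq> ?\<pi> ?X" using n(2) by auto
      show "ln (2 * real ?n) \<le> ln x" using n elim(2) by (subst ln_le_cancel_iff) auto
      show "0 \<le> ln (2 * real ?n)" by (intro ln_ge_zero) (use n(1) in linarith)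
    qed auto
    finally have \<pi>: "(x / 2 - 1) / ln x \<le> real (card (?\<pi> ?X)) + 1"
      using lnx by (simp add: pos_divide_le_eq)
    show ?case
    proof (intro allI impI)
      fix y :: nat assume y: "real y \<le> log 2 x / 8"
      have "?\<pi> ?X \<subseteq> {1..y} \<union> {p. prime p \<and> y < p \<and> p \<le> ?X}"
        by (auto simp: Suc_le_eq prime_gt_0_nat)
      then have "card (?\<pi> ?X) \<le> card ({1..y} \<union> {p. prime p \<and> y < p \<and> p \<le> ?X})"
        by (intro card_mono) auto
      also have "\<dots> \<le> card {1..y} + card {p. prime p \<and> y < p \<and> p \<le> ?X}" by (rule card_Un_le)
      finally have "real (card (?\<pi> ?X)) \<le> real y + real (card {p. prime p \<and> y < p \<and> p \<le> ?X})"
        by simp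
      then show "x / (8 * ln x) \<le> real (card {p. prime p \<and> y < p \<and> p \<le> ?X})"
        using \<pi> y elim(1) by linarith
    qed
  qed
qed

text \<open>The 8 under the logarithm makes the primorial at most 4^(2^a) \<le>
  \<open>x powr (1/4)\<close>, negligible against the number of primes. The 16 combines the 2 from
  the averaging with the 8 from the prime count.\<close>

lemma tuple_count_max_ge_eventually:
  fixes k :: nat
  assumes "k \<ge> 1"
  shows "eventually (\<lambda>x::real. \<forall>a G. 2 ^ a \<le> log 2 x / 8 \<longrightarrow> a > 0 \<longrightarrow>
     (\<forall>E\<in>difference_sets k. real (tuple_count x E) \<le> G) \<longrightarrow>
       x * mertens_product (2 ^ a) ^ k \<le> (16 * real (k + 1) * ln x) ^ (k + 1) * G) at_top"
proof -
  have "eventually (\<lambda>x::real. 2 * real (k + 1) * x powr (1/4) \<le> x / (8 * ln x)) at_top"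
    by real_asymp
  moreover have "eventually (\<lambda>x::real. x \<ge> 4) at_top" by (rule eventually_ge_at_top)
  ultimately show ?thesis using card_primes_ge_eventually
  proof eventually_elim
    case (elim x)
    show ?case
    proof (intro allI impI)
      fix a :: nat and G :: real
      assume a: "2 ^ a \<le> log 2 x / 8" "a > 0"
        and G: "\<forall>E\<in>difference_sets k. real (tuple_count x E) \<le> G"
      let ?y = "2 ^ a :: nat" and ?X = "nat \<lfloor>x\<rfloor>"
      let ?P = "\<Prod>{p::nat. prime p \<and> p \<le> ?y}"
      let ?M = "card {p::nat. prime p \<and> ?y < p \<and> p \<le> ?X}"
      have lnx: "ln x > 0" using elim(2) by simp
      have M: "x / (8 * ln x) \<le> real ?M" using elim(3) a by simp
      have "real ?P \<le> real (4 ^ ?y)" by (intro of_nat_mono primorial_le)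
      also have "\<dots> = 2 ^ (2 * ?y)" by (simp add: power_mult)
      also have "\<dots> \<le> x powr (1/4)" using a elim(2) by (intro power2_le_powr) auto
      finally have "2 * real (k + 1) * real ?P \<le> 2 * real (k + 1) * x powr (1/4)"
        by (intro mult_left_mono) auto
      also have "\<dots> \<le> real ?M" using elim(1) M by linarith
      finally have "real (2 * (k + 1) * ?P) \<le> real ?M"
        by (simp only: of_nat_mult of_nat_numeral)
      then have big: "2 * (k + 1) * ?P \<le> ?M" by (simp only: of_nat_le_iff)
      have X: "real ?X \<le> x" using elim(2) by linarith
      have y2: "2 \<le> ?y" using a(2) power_increasing[of 1 a "2::nat"] by simp
      have "int ` {1..k} \<in> difference_sets k" by (auto simp: difference_sets_def card_image)
      with G have G0: "0 \<le> G" by (meson order.trans of_nat_0_le_iff)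
      have "(x / (8 * ln x)) ^ (k + 1) * mertens_product ?y ^ k \<le> real ?M ^ (k + 1) * mertens_product ?y ^ k"
        using M lnx elim(2) mertens_product_ge_1[of ?y]
        by (intro mult_right_mono power_mono) auto
      also have "\<dots> \<le> (2 * real (k + 1)) ^ (k + 1) * real ?X ^ k * G"
        by (rule tuple_count_lower_bound[OF assms y2 X big]) (use G in blast)
      also have "\<dots> \<le> (2 * real (k + 1)) ^ (k + 1) * x ^ k * G"
        using X G0 by (intro mult_right_mono mult_left_mono power_mono) auto
      finally have "(x / (8 * ln x)) ^ (k + 1) * mertens_product ?y ^ k
          \<le> (2 * real (k + 1)) ^ (k + 1) * x ^ k * G" .
      then have "(x / (8 * ln x)) ^ (k + 1) * mertens_product ?y ^ k * ((8 * ln x) ^ (k + 1) / x ^ k)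
          \<le> (2 * real (k + 1)) ^ (k + 1) * x ^ k * G * ((8 * ln x) ^ (k + 1) / x ^ k)"
        using lnx elim(2) by (intro mult_right_mono) auto
      moreover have "(x / (8 * ln x)) ^ (k + 1) * mertens_product ?y ^ k * ((8 * ln x) ^ (k + 1) / x ^ k)
          = x * mertens_product ?y ^ k"
        using lnx elim(2) by (simp add: power_divide)
      moreover have "(2 * real (k + 1)) ^ (k + 1) * x ^ k * G * ((8 * ln x) ^ (k + 1) / x ^ k)
          = (2 * real (k + 1) * (8 * ln x)) ^ (k + 1) * G"
        unfolding power_mult_distrib[of "2 * real (k + 1)"] using elim(2) by simp
      moreover have "2 * real (k + 1) * (8 * ln x) = 16 * real (k + 1) * ln x" by simp
      ultimately show "x * mertens_product (2 ^ a) ^ k \<le> (16 * real (k + 1) * ln x) ^ (k + 1) * G"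
        by (simp only:)
    qed
  qed
qed

text \<open>Passes from integers to naturals in the form the sieve expects: the adjoined 0 stands
  for the smallest prime itself, and since \<open>Max D\<close> is positive this prime is at most
  \<open>x\<close>.\<close>

lemma tuple_count_le:
  assumes "finite D" "\<And>d. d \<in> D \<Longrightarrow> d > 0" "D \<noteq> {}"
  shows "tuple_count x D \<le> card {n. n < nat \<lfloor>x\<rfloor> + 1 \<and> (\<forall>h\<in>insert 0 (nat ` D). prime (n + h))}"
  unfolding tuple_count_def
proof (rule card_inj_on_le)
  let ?S = "{p :: int. prime p \<and> real_of_int p \<le> x - real_of_int (Max D) \<and> (\<forall>d\<in>D. prime (p + d))}"
  show "inj_on nat ?S"
    by (intro inj_onI) (auto simp: eq_nat_nat_iff prime_ge_0_int)
  have "Max D > 0" using assms by auto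
  show "nat ` ?S \<subseteq> {n. n < nat \<lfloor>x\<rfloor> + 1 \<and> (\<forall>h\<in>insert 0 (nat ` D). prime (n + h))}"
  proof
    fix n assume "n \<in> nat ` ?S"
    then obtain p where p: "p \<in> ?S" "n = nat p" by blast
    have p0: "p \<ge> 0" using p(1) prime_ge_0_int by simp
    have "real_of_int p \<le> x" using p(1) \<open>Max D > 0\<close> by simp
    then have "n < nat \<lfloor>x\<rfloor> + 1" using p(2) p0 by (simp add: le_floor_iff less_Suc_eq_le nat_le_iff)
    moreover have "prime (n + h)" if "h \<in> insert 0 (nat ` D)" for h
    proof -
      have "h = 0 \<or> (\<exists>d\<in>D. h = nat d)" using that by blast
      then show ?thesis
      proof
        assume "h = 0"
        then show ?thesis using p by simp
      next
        assume "\<exists>d\<in>D. h = nat d"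
        then obtain d where d: "d \<in> D" "h = nat d" by blast
        then have "n + h = nat (p + d)" using p0 p(2) assms(2)[of d] by (simp add: nat_add_distrib)
        then show ?thesis using p(1) d(1) by simp
      qed
    qed
    ultimately show "n \<in> {n. n < nat \<lfloor>x\<rfloor> + 1 \<and> (\<forall>h\<in>insert 0 (nat ` D). prime (n + h))}" by blast
  qed
qed auto

lemma tuple_count_le_eventually:
  fixes k :: nat
  assumes "k \<ge> 1"
  obtains C where "C > 0" and
    "eventually (\<lambda>x::real. \<forall>y D. log 2 x < 16 * real y \<longrightarrow> D \<in> difference_sets k \<longrightarrow>
       (\<forall>d\<in>D. real_of_int d \<le> x) \<longrightarrow>
       real (tuple_count x D) \<le> C * x / ln x ^ (k + 1) * mertens_product y ^ (k - 1) *
          2 ^ card (prime_factors (Gcd D)) + 3 * sqrt x) at_top"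
proof -
  define \<kappa> where "\<kappa> = k + 1"
  \<comment> \<open>Any level depending only on \<open>k\<close> with
    \<open>2 * \<kappa> \<le> 2 ^ (2 ^ j0)\<close> would serve; here n < 2^n is applied
    twice.\<close>
  define j0 where "j0 = 2 * \<kappa>"
  define M0 where "M0 = mertens_product (2 ^ (2 ^ j0))"
  \<comment> \<open>The 2 comes from \<open>N\<close> \<le> 2x, the 64 from \<open>ln z\<close>
    \<ge> \<open>ln x / 64\<close>, and the last exponential from \<open>t = 16 * y\<close> in the
    sieve bound.\<close>
  define C where "C = 2 * exp (exp (6 * real \<kappa>)) * (64 * M0) ^ \<kappa> * exp (16 * real (\<kappa>\<^sup>2)) ^ (k - 1)"
  have M0: "M0 \<ge> 1" by (simp add: M0_def mertens_product_ge_1)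
  have \<kappa>: "\<kappa> \<ge> 2" using assms by (simp add: \<kappa>_def)
  have "j0 \<le> 2 ^ j0" by (rule less_imp_le, rule less_exp)
  also have "\<dots> \<le> 2 ^ (2 ^ j0)" by (rule less_imp_le, rule less_exp)
  finally have j0: "2 * \<kappa> \<le> 2 ^ (2 ^ j0)" by (simp only: j0_def)
  have "C > 0" using M0 by (simp add: C_def)
  moreover have "eventually (\<lambda>x::real. log 2 x \<ge> 32 * 2 ^ j0) at_top" by real_asymp
  then have "eventually (\<lambda>x::real. \<forall>y D. log 2 x < 16 * real y \<longrightarrow> D \<in> difference_sets k \<longrightarrow>
       (\<forall>d\<in>D. real_of_int d \<le> x) \<longrightarrow>
       real (tuple_count x D) \<le> C * x / ln x ^ (k + 1) * mertens_product y ^ (k - 1) *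
          2 ^ card (prime_factors (Gcd D)) + 3 * sqrt x) at_top"
    using eventually_ge_at_top[of 4]
  proof eventually_elim
    case (elim x)
    have "log 2 x / 32 \<ge> 2 ^ j0" using elim(1) by simp
    moreover have "(2::real) ^ j0 \<ge> 1" by simp
    \<comment> \<open>The sieve level \<open>z\<close> then lies between the powers 1/64 and 1/32 of
      \<open>x\<close>: its 16th power is at most \<open>sqrt x\<close>, yet \<open>ln z\<close> is
      comparable to \<open>ln x\<close>.\<close>
    ultimately obtain J where J: "2 ^ J \<le> log 2 x / 32" "log 2 x / 32 < 2 * 2 ^ J"
      using ex_power2_between[of "log 2 x / 32"] by fastforce
    have "(2::real) ^ j0 < 2 ^ Suc J" using elim(1) J(2) by simp
    then have "j0 < Suc J" using power_less_imp_less_exp[of "2::real" j0 "Suc J"] by simp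
    then have J0: "j0 \<le> J" by simp
    define z :: nat where "z = 2 ^ (2 ^ J)"
    have lnx: "ln x > 0" using elim(2) by simp
    have "log 2 x / 64 * ln 2 \<le> 2 ^ J * ln 2"
      using J(2) by (intro mult_right_mono) auto
    then have lnz: "ln x / 64 \<le> ln (real z)"
      by (simp add: z_def ln_realpow log_def)
    have z16: "real z ^ 16 \<le> sqrt x"
    proof -
      have "real z ^ 16 = 2 ^ (2 ^ J * 16)" by (simp add: z_def power_mult)
      also have "\<dots> \<le> x powr (1/2)" using J(1) elim(2) by (intro power2_le_powr) auto
      finally show ?thesis using elim(2) by (simp add: powr_half_sqrt)
    qed
    have z1: "1 \<le> real z" by (simp add: z_def)
    then have "real z \<le> real z ^ 16" by (intro self_le_power) auto
    with z1 z16 have err: "real z ^ 16 + real z + 1 \<le> 3 * sqrt x" by linarith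
    show ?case
    proof (intro allI impI)
      fix y :: nat and D :: "int set"
      assume y: "log 2 x < 16 * real y" and D: "D \<in> difference_sets k"
        and Dx: "\<forall>d\<in>D. real_of_int d \<le> x"
      define H where "H = insert 0 (nat ` D)"
      define F where "F = nat ` prime_factors (Gcd D)"
      define N where "N = nat \<lfloor>x\<rfloor> + 1"
      have D': "finite D" "\<And>d. d \<in> D \<Longrightarrow> d > 0" "card D = k"
        using D by (auto simp: difference_sets_def)
      then have "D \<noteq> {}" using assms by auto
      then obtain d0 where d0: "d0 \<in> D" by blast
      have "Gcd D \<noteq> 0" using d0 D'(2)[OF d0] by (auto simp: Gcd_0_iff)
      have "y > 0"
      proof (rule ccontr)
        assume "\<not> y > 0"
        then have "log 2 x < 0" using y by simp
        moreover have "0 \<le> 32 * (2::real) ^ j0" by simp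
        ultimately show False using elim(1) by linarith
      qed
      \<comment> \<open>Differences below 2^(16 y) allow \<open>t = 16 * y\<close>, so the exponent
        \<kappa>^2 t / y of the sieve bound is a constant.\<close>
      have x_lt: "x < 2 ^ (16 * y)"
      proof -
        have "x = 2 powr (log 2 x)" using elim(2) by simp
        also have "\<dots> < 2 powr real (16 * y)" using y by (intro powr_less_mono) auto
        also have "\<dots> = 2 ^ (16 * y)" by (rule powr_realpow) simp
        finally show ?thesis .
      qed
      have inj: "inj_on nat D" using D'(2) by (intro inj_onI) (metis eq_nat_nat_iff less_imp_le)
      have "0 \<notin> nat ` D" using D'(2) by force
      then have cardH: "card H = \<kappa>" using D' inj by (simp add: H_def card_image \<kappa>_def)
      have upper: "real (card {n. n < N \<and> (\<forall>h\<in>H. prime (n + h))})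
           \<le> exp (exp (6 * real \<kappa>)) * real N *
               ((mertens_product (2 ^ (2 ^ j0)) / ln (real (2 ^ (2 ^ J)))) ^ \<kappa> *
                (mertens_product y * exp (real (\<kappa>\<^sup>2 * (16 * y)) / real y)) ^ (\<kappa> - 2) * 2 ^ card F)
             + real (2 ^ (2 ^ J)) ^ 16 + real (2 ^ (2 ^ J)) + 1"
      proof (rule prime_tuple_upper_bound[OF _ _ cardH _ \<kappa> j0 J0 \<open>y > 0\<close>])
        show "finite H" "0 \<in> H" using D'(1) by (auto simp: H_def)
        show "h < 2 ^ (16 * y)" if "h \<in> H" for h
        proof -
          have "real h \<le> x" using that Dx D'(2) elim(2) by (auto simp: H_def less_imp_le)
          then have "real h < 2 ^ (16 * y)" using x_lt by linarith
          then have "real h < real (2 ^ (16 * y))" by (simp only: of_nat_power of_nat_numeral)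
          then show ?thesis by (simp only: of_nat_less_iff)
        qed
        show "finite F" by (simp add: F_def)
        show "prime p" if "p \<in> F" for p using that by (auto simp: F_def)
        show "p \<in> F" if p: "prime p" "\<And>h. h \<in> H \<Longrightarrow> p dvd h" for p
        proof -
          have "int p dvd d" if "d \<in> D" for d
          proof -
            have "p dvd nat d" using that p(2) by (simp add: H_def)
            then show ?thesis using D'(2)[OF that] by (simp add: int_dvd_int_iff[symmetric])
          qed
          then have "int p dvd Gcd D" by (rule Gcd_greatest)
          then have "int p \<in> prime_factors (Gcd D)"
            using p(1) \<open>Gcd D \<noteq> 0\<close> by (simp add: in_prime_factors_iff)
          then show ?thesis unfolding F_def by (metis image_eqI nat_int)
        qed
      qed
      have N: "real N \<le> 2 * x" using elim(2) unfolding N_def by linarith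
      have cardF: "(2::real) ^ card F \<le> 2 ^ card (prime_factors (Gcd D))"
        unfolding F_def by (intro power_increasing card_image_le) auto
      have "M0 / ln (real z) \<le> M0 / (ln x / 64)"
        using lnz lnx M0 by (intro divide_left_mono mult_pos_pos) auto
      then have base: "M0 / ln (real z) \<le> 64 * M0 / ln x" by (simp add: mult.commute)
      have base0: "0 \<le> M0 / ln (real z)" using M0 z1 by simp
      have E: "exp (real (\<kappa>\<^sup>2 * (16 * y)) / real y) = exp (16 * real (\<kappa>\<^sup>2))"
        using \<open>y > 0\<close> by simp
      let ?W = "mertens_product y"
      have W: "1 \<le> ?W" by (rule mertens_product_ge_1)
      have "real (tuple_count x D) \<le> real (card {n. n < N \<and> (\<forall>h\<in>H. prime (n + h))})"
        unfolding N_def H_def by (intro of_nat_mono tuple_count_le) (use D' \<open>D \<noteq> {}\<close> in auto)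
      also have "\<dots> \<le> exp (exp (6 * real \<kappa>)) * real N *
               ((M0 / ln (real z)) ^ \<kappa> * (?W * exp (16 * real (\<kappa>\<^sup>2))) ^ (k - 1) * 2 ^ card F) + 3 * sqrt x"
        using upper err unfolding E by (simp add: M0_def z_def \<kappa>_def)
      also have "exp (exp (6 * real \<kappa>)) * real N *
               ((M0 / ln (real z)) ^ \<kappa> * (?W * exp (16 * real (\<kappa>\<^sup>2))) ^ (k - 1) * 2 ^ card F)
          \<le> exp (exp (6 * real \<kappa>)) * (2 * x) *
               ((64 * M0 / ln x) ^ \<kappa> * (?W * exp (16 * real (\<kappa>\<^sup>2))) ^ (k - 1) * 2 ^ card (prime_factors (Gcd D)))"
        using N cardF base base0 W elim(2)
        by (intro mult_mono power_mono mult_nonneg_nonneg zero_le_power order.refl) auto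
      also have "\<dots> = C * x / ln x ^ (k + 1) * ?W ^ (k - 1) * 2 ^ card (prime_factors (Gcd D))"
        by (simp add: C_def \<kappa>_def power_mult_distrib power_divide)
      finally show "real (tuple_count x D) \<le> C * x / ln x ^ (k + 1) * ?W ^ (k - 1) *
          2 ^ card (prime_factors (Gcd D)) + 3 * sqrt x"
        by simp
    qed
  qed
  ultimately show ?thesis by (rule that)
qed

section \<open>Comparison of the bounds for a champion\<close>

text \<open>All prime factors lie in \<open>{1..g}\<close>. Through this crude bound the growth of
  the gcd follows from that of its number of prime factors.\<close>

lemma card_prime_factors_le:
  fixes g :: int
  assumes "g > 0"
  shows "int (card (prime_factors g)) \<le> g"
proof -
  have "prime_factors g \<subseteq> {1..g}"
  proof
    fix p assume p: "p \<in> prime_factors g"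
    then have "p dvd g" "prime p" by auto
    then show "p \<in> {1..g}" using assms prime_gt_0_int[of p] by (auto dest: zdvd_imp_le)
  qed
  then have "card (prime_factors g) \<le> nat g"
    using card_mono[of "{1..g}"] by fastforce
  then show ?thesis using assms by linarith
qed

lemma champion_ln_le_eventually:
  fixes k :: nat
  assumes "k \<ge> 1"
  obtains B where "B > 0" and
    "eventually (\<lambda>x::real. \<forall>D. tuple_PDC k x D \<longrightarrow>
       ln (log 2 x / 16) \<le> B * 2 ^ card (prime_factors (Gcd D))) at_top"
proof -
  obtain C where C: "C > 0" and upper:
    "eventually (\<lambda>x::real. \<forall>y D. log 2 x < 16 * real y \<longrightarrow> D \<in> difference_sets k \<longrightarrow>
       (\<forall>d\<in>D. real_of_int d \<le> x) \<longrightarrow>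
       real (tuple_count x D) \<le> C * x / ln x ^ (k + 1) * mertens_product y ^ (k - 1) *
          2 ^ card (prime_factors (Gcd D)) + 3 * sqrt x) at_top"
    using tuple_count_le_eventually[OF assms] by blast
  define A where "A = (16 * real (k + 1)) ^ (k + 1)"
  have A: "A > 0" by (simp add: A_def)
  have "eventually (\<lambda>x::real. A * ln x powr real (k + 1) * (3 * sqrt x) \<le> x / 2) at_top"
    using A by real_asymp
  moreover have "eventually (\<lambda>x::real. log 2 x \<ge> 16) at_top" by real_asymp
  moreover note eventually_ge_at_top[of "4::real"] upper tuple_count_max_ge_eventually[OF assms]
  ultimately have "eventually (\<lambda>x::real. \<forall>D. tuple_PDC k x D \<longrightarrow>
       ln (log 2 x / 16) \<le> 2 * A * C * 2 ^ card (prime_factors (Gcd D))) at_top"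
  proof eventually_elim
    case (elim x)
    show ?case
    proof (intro allI impI)
      fix D assume "tuple_PDC k x D"
      then have D: "D \<in> difference_sets k"
        and max: "\<And>E. E \<in> difference_sets k \<Longrightarrow> tuple_count x E \<le> tuple_count x D"
        by (auto simp: tuple_PDC_def is_arg_max_def not_less)
      \<comment> \<open>The level 2^a is pinned between \<open>log 2 x / 16\<close> and
        \<open>log 2 x / 8\<close>: the lower bound for the maximum needs it small, the sieve bound
        needs it large.\<close>
      obtain a where a: "2 ^ a \<le> log 2 x / 8" "log 2 x / 8 < 2 * 2 ^ a"
        using ex_power2_between[of "log 2 x / 8"] elim(2) by auto
      have "a > 0" using a(2) elim(2) by (cases a) auto
      let ?y = "2 ^ a :: nat" and ?G = "real (tuple_count x D)" and ?\<omega> = "card (prime_factors (Gcd D))"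
      let ?W = "mertens_product ?y"
      have W: "1 \<le> ?W" by (rule mertens_product_ge_1)
      have lnx: "ln x > 0" using elim(3) by simp
      have "x * ?W ^ k \<le> (16 * real (k + 1) * ln x) ^ (k + 1) * ?G"
        by (rule elim(5)[rule_format, OF a(1) \<open>a > 0\<close>]) (use max in simp)
      then have lower: "x * ?W ^ k \<le> A * ln x ^ (k + 1) * ?G"
        by (simp only: A_def power_mult_distrib[of "16 * real (k + 1)"])
      have "0 < x * ?W ^ k" using elim(3) W by (intro mult_pos_pos zero_less_power) auto
      \<comment> \<open>A champion counts at least one prime p \<le> x - \<open>Max D\<close>, which
        forces its elements below \<open>x\<close>, as the sieve bound requires.\<close>
      with lower have "tuple_count x D \<noteq> 0" by (intro notI) simp
      then obtain p :: int where p: "prime p" "real_of_int p \<le> x - real_of_int (Max D)"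
        unfolding tuple_count_def by (metis (mono_tags, lifting) card.empty empty_Collect_eq)
      have "real_of_int d \<le> x" if "d \<in> D" for d
      proof -
        have "d \<le> Max D" using that D by (intro Max_ge) (auto simp: difference_sets_def)
        moreover have "p > 0" using p(1) by (rule prime_gt_0_int)
        ultimately show ?thesis using p(2) by linarith
      qed
      moreover have "log 2 x < 16 * real ?y" using a(2) by simp
      ultimately have "?G \<le> C * x / ln x ^ (k + 1) * ?W ^ (k - 1) * 2 ^ ?\<omega> + 3 * sqrt x"
        using elim(4) D by blast
      then have "A * ln x ^ (k + 1) * ?G \<le> A * ln x ^ (k + 1) * (C * x / ln x ^ (k + 1) * ?W ^ (k - 1) * 2 ^ ?\<omega> + 3 * sqrt x)"
        using A lnx by (intro mult_left_mono) auto
      also have "\<dots> = A * C * x * ?W ^ (k - 1) * 2 ^ ?\<omega> + A * ln x ^ (k + 1) * (3 * sqrt x)"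
        using lnx by (simp add: distrib_left)
      \<comment> \<open>The sieve remainder is at most half of the lower bound and is moved to the
        left side; hence the factor 2 in the final constant.\<close>
      also have "A * ln x ^ (k + 1) * (3 * sqrt x) \<le> x / 2"
        using elim(1) lnx by (simp only: powr_realpow)
      also have "x / 2 \<le> x * ?W ^ k / 2"
        using elim(3) one_le_power[OF W, of k] by simp
      finally have "x * ?W ^ k \<le> 2 * A * C * x * ?W ^ (k - 1) * 2 ^ ?\<omega>"
        using lower by linarith
      moreover have "?W ^ k = ?W * ?W ^ (k - 1)" using assms by (simp add: power_eq_if)
      ultimately have "?W * (x * ?W ^ (k - 1)) \<le> 2 * A * C * 2 ^ ?\<omega> * (x * ?W ^ (k - 1))"
        by (simp add: mult_ac)
      moreover have "0 < x * ?W ^ (k - 1)"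
        using elim(3) W by (intro mult_pos_pos zero_less_power) auto
      ultimately have "?W \<le> 2 * A * C * 2 ^ ?\<omega>" by (simp only: mult_le_cancel_right_pos)
      moreover have "ln (log 2 x / 16) \<le> ln (real ?y)"
        using a(2) elim(2) by (subst ln_le_cancel_iff) auto
      moreover have "ln (real ?y) \<le> ?W" by (rule ln_le_mertens_product) simp
      ultimately show "ln (log 2 x / 16) \<le> 2 * A * C * 2 ^ ?\<omega>" by linarith
    qed
  qed
  moreover have "2 * A * C > 0" using A C by simp
  ultimately show ?thesis by (rule that[rotated])
qed

theorem theorem1p1:
  fixes k :: nat and Dstar :: "real \<Rightarrow> int set"
  assumes "k \<ge> 1"
    and "eventually (\<lambda>x. tuple_PDC k x (Dstar x)) at_top"
  shows "filterlim (\<lambda>x. Gcd (Dstar x)) at_top at_top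
       \<and> filterlim (\<lambda>x. card (prime_factors (Gcd (Dstar x)))) at_top at_top"
proof -
  obtain B where "B > 0" and B: "eventually (\<lambda>x::real. \<forall>D. tuple_PDC k x D \<longrightarrow>
       ln (log 2 x / 16) \<le> B * 2 ^ card (prime_factors (Gcd D))) at_top"
    using champion_ln_le_eventually[OF assms(1)] by blast
  have many: "eventually (\<lambda>x. Z \<le> card (prime_factors (Gcd (Dstar x)))) at_top" for Z
  proof -
    have "filterlim (\<lambda>x::real. ln (log 2 x / 16)) at_top at_top" by real_asymp
    then have "eventually (\<lambda>x::real. B * 2 ^ Z \<le> ln (log 2 x / 16)) at_top"
      by (simp add: filterlim_at_top)
    with B assms(2) show ?thesis
    proof eventually_elim
      case (elim x)
      then have "B * 2 ^ Z \<le> B * 2 ^ card (prime_factors (Gcd (Dstar x)))" by fastforce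
      then have "(2::real) ^ Z \<le> 2 ^ card (prime_factors (Gcd (Dstar x)))" using \<open>B > 0\<close> by simp
      then show ?case by simp
    qed
  qed
  have "eventually (\<lambda>x. Z \<le> Gcd (Dstar x)) at_top" for Z
    using many[of "nat Z"] assms(2)
  proof eventually_elim
    case (elim x)
    have D: "finite (Dstar x)" "card (Dstar x) = k" "\<forall>d\<in>Dstar x. d > 0"
      using elim(2) by (auto simp: tuple_PDC_def is_arg_max_def difference_sets_def)
    then have "Dstar x \<noteq> {}" using assms(1) by auto
    then have "Gcd (Dstar x) \<noteq> 0" using D(3) by (auto simp: Gcd_0_iff)
    then have "Gcd (Dstar x) > 0" by (metis Gcd_int_greater_eq_0 order_le_less)
    then show ?case using card_prime_factors_le[of "Gcd (Dstar x)"] elim(1) by linarith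
  qed
  with many show ?thesis by (simp add: filterlim_at_top)
qed

end
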